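(* Let $V\in\Gamma_{sc}^2(\mathbb{R}^m)$ and let $(\overline{x},\overline{\sigma})\in X_0\times S^-$ be a critical point of $\Xi$ such that $\det\nabla^2f(\overline{x})\neq0$. Let $E$ be a real $n\times n$ matrix with $E^*E=-A(\overline{\sigma})$ and $F$ a real $m\times m$ matrix with $F^*F=\nabla^2V(q(\overline{x}))$ (both are then non-singular), let $d_i:=(E^{-1})^*(A_i\overline{x}-b_i)\in\mathbb{R}^n$ for $i\in\{1,\dots,m\}$, let $J:\mathbb{R}^m\to\mathbb{R}^n$, $Jv:=\sum_{i=1}^mv_id_i$, and let $H:=J\circ F^*:\mathbb{R}^m\to\mathbb{R}^n$. Let $S_m$ denote the Euclidean unit sphere of $\mathbb{R}^m$. Then: (a) $\overline{x}$ is a local maximizer of $f$ if and only if $\|Hv\|<1$ for all $v\in S_m$, if and only if $\overline{\sigma}$ is a local maximizer of $D$. (b) Assume that $m=n$. Then $\overline{x}$ is a local minimizer of $f$ if and only if $\|Hv\|>1$ for all $v\in S_m$, if and only if $\overline{\sigma}$ is a local minimizer of $D$.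
   Context: $\Gamma(\mathbb{R}^m)$ is the class of proper convex lower semicontinuous functions $g:\mathbb{R}^m\to\overline{\mathbb{R}}=\mathbb{R}\cup\{-\infty,+\infty\}$; $\operatorname{dom}g=\{y: g(y)<\infty\}$; $g^*(\sigma)=\sup_{y}\{\langle y,\sigma\rangle-g(y)\}$ is the Fenchel conjugate. $\Gamma_{sc}(\mathbb{R}^m)$ is the class of $g\in\Gamma(\mathbb{R}^m)$ of Legendre type, i.e. essentially smooth ($\operatorname{int}(\operatorname{dom}g)\ne\emptyset$, $g$ differentiable there, and $\|\nabla g(y_k)\|\to\infty$ whenever $(y_k)\subset\operatorname{int}(\operatorname{dom}g)$ converges to a boundary point of $\operatorname{int}(\operatorname{dom}g)$) and essentially strictly convex (strictly convex on every convex subset of $\{y:\partial g(y)\neq\emptyset\}$). $\Gamma_{sc}^2(\mathbb{R}^m)$ is the class of $g\in\Gamma_{sc}(\mathbb{R}^m)$ that are twice differentiable on $\operatorname{int}(\operatorname{dom}g)$ with $\nabla^2g(y)\succ0$ for all $y\in\operatorname{int}(\operatorname{dom}g)$; then $g^*\in\Gamma_{sc}^2(\mathbb{R}^m)$. For $i\in\{0,\dots,m\}$ let $q_i(x)=\tfrac12\langle x,A_ix\rangle-\langle b_i,x\rangle+c_i$ on $\mathbb{R}^n$, with $A_i$ a real symmetric $n\times n$ matrix, $b_i\in\mathbb{R}^n$, $c_i\in\mathbb{R}$, and $q(x)=(q_1(x),\dots,q_m(x))^T$. Let $f:=q_0+V\circ q$ and $X_0:=\{x\in\mathbb{R}^n: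 q(x)\in\operatorname{int}(\operatorname{dom}V)\}$. For $\sigma\in\mathbb{R}^m$ put, with $\sigma_0:=1$, $A(\sigma)=\sum_{k=0}^m\sigma_kA_k$, $b(\sigma)=\sum_{k=0}^m\sigma_kb_k$, $c(\sigma)=\sum_{k=0}^m\sigma_kc_k$, and let $$\Xi(x,\sigma)=q_0(x)+\langle q(x),\sigma\rangle-V^*(\sigma)=\tfrac12\langle x,A(\sigma)x\rangle-\langle b(\sigma),x\rangle+c(\sigma)-V^*(\sigma).$$ Sets: $S_{\mathrm{col}}=\{\sigma\in\operatorname{dom}V^*: b(\sigma)\in\operatorname{Im}A(\sigma)\}$; $S^-=\{\sigma\in\operatorname{dom}V^*:A(\sigma)\prec0\}$. The dual function is $D:S_{\mathrm{col}}\to\mathbb{R}$, $D(\sigma):=\Xi(x,\sigma)$ for any $x$ with $A(\sigma)x=b(\sigma)$ (the value does not depend on the choice of such $x$). "$(\overline{x},\overline{\sigma})$ is a critical point of $\Xi$" means $\overline{\sigma}\in\operatorname{int}(\operatorname{dom}V^* )$ and $\nabla\Xi(\overline{x},\overline{\sigma})=0$ (equivalently $\overline{\sigma}=\nabla V(q(\overline{x}))$ and $A(\overline{\sigma})\overline{x}=b(\overline{\sigma})$). A star on a matrix or linear operator denotes transpose/adjoint. *)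

theory Defs
  imports "HOL-Analysis.Analysis"
begin

section \<open>Differential calculus\<close>

definition gradient :: "('a::real_inner \<Rightarrow> real) \<Rightarrow> 'a \<Rightarrow> 'a" where
  "gradient f x = (THE D. GDERIV f x :> D)"

definition hessian :: "(real^'n \<Rightarrow> real) \<Rightarrow> real^'n \<Rightarrow> real^'n^'n" where
  "hessian f x = jacobian (gradient f) (at x)"

lemma gradient_eqI:
  assumes "GDERIV f x :> D"
  shows "gradient f x = D"
  unfolding gradient_def
proof (rule the_equality)
  fix D' assume "GDERIV f x :> D'"
  then have "(\<lambda>h. h \<bullet> D') = (\<lambda>h. h \<bullet> D)"
    using assms unfolding gderiv_def by (rule has_derivative_unique)
  then show "D' = D"
    by (metis inner_commute vector_eq_rdot)
qed (rule assms)

lemma GDERIV_gradient: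
  fixes f :: "'a::euclidean_space \<Rightarrow> real"
  assumes "f differentiable (at x)"
  shows "GDERIV f x :> gradient f x"
proof -
  obtain f' where f': "(f has_derivative f') (at x)"
    using assms by (auto simp: differentiable_def)
  then interpret bounded_linear f'
    by (rule has_derivative_bounded_linear)
  have "f' = (\<lambda>h. h \<bullet> (\<Sum>b\<in>Basis. f' b *\<^sub>R b))"
  proof
    fix h
    have "f' h = f' (\<Sum>b\<in>Basis. (h \<bullet> b) *\<^sub>R b)"
      by (simp add: euclidean_representation)
    then show "f' h = h \<bullet> (\<Sum>b\<in>Basis. f' b *\<^sub>R b)"
      by (simp add: sum scaleR inner_sum_right mult.commute)
  qed
  then have "GDERIV f x :> (\<Sum>b\<in>Basis. f' b *\<^sub>R b)"
    unfolding gderiv_def by (rule subst) (rule f')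
  moreover from this have "gradient f x = (\<Sum>b\<in>Basis. f' b *\<^sub>R b)"
    by (rule gradient_eqI)
  ultimately show ?thesis
    by simp
qed

definition pos_definite :: "real^'n^'n \<Rightarrow> bool" where
  "pos_definite M \<longleftrightarrow> transpose M = M \<and> (\<forall>x. x \<noteq> 0 \<longrightarrow> x \<bullet> (M *v x) > 0)"

definition neg_definite :: "real^'n^'n \<Rightarrow> bool" where
  "neg_definite M \<longleftrightarrow> transpose M = M \<and> (\<forall>x. x \<noteq> 0 \<longrightarrow> x \<bullet> (M *v x) < 0)"

definition local_maximizer_on :: "'a::metric_space set \<Rightarrow> ('a \<Rightarrow> 'b::order) \<Rightarrow> 'a \<Rightarrow> bool" where
  "local_maximizer_on S f x \<longleftrightarrow> x \<in> S \<and> (\<exists>e>0. \<forall>y\<in>S \<inter> ball x e. f y \<le> f x)"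

definition local_minimizer_on :: "'a::metric_space set \<Rightarrow> ('a \<Rightarrow> 'b::order) \<Rightarrow> 'a \<Rightarrow> bool" where
  "local_minimizer_on S f x \<longleftrightarrow> x \<in> S \<and> (\<exists>e>0. \<forall>y\<in>S \<inter> ball x e. f x \<le> f y)"


section \<open>Extended-real-valued convex functions\<close>

definition edom :: "('a \<Rightarrow> ereal) \<Rightarrow> 'a set" where
  "edom g = {y. g y < \<infinity>}"

definition fenchel_conj :: "('a::real_inner \<Rightarrow> ereal) \<Rightarrow> 'a \<Rightarrow> ereal" where
  "fenchel_conj g \<sigma> = (SUP y. ereal (y \<bullet> \<sigma>) - g y)"

definition proper :: "('a \<Rightarrow> ereal) \<Rightarrow> bool" where
  "proper g \<longleftrightarrow> edom g \<noteq> {} \<and> (\<forall>y. g y > -\<infinity>)"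

definition lower_semicont :: "('a::topological_space \<Rightarrow> ereal) \<Rightarrow> bool" where
  "lower_semicont g \<longleftrightarrow> (\<forall>y. g y \<le> Liminf (at y) g)"

text \<open>Only used for proper \<open>g\<close>, so that the right-hand side is never \<open>\<infinity> - \<infinity>\<close>.\<close>

definition econvex :: "('a::real_vector \<Rightarrow> ereal) \<Rightarrow> bool" where
  "econvex g \<longleftrightarrow> (\<forall>y z. \<forall>u::real. 0 < u \<and> u < 1 \<longrightarrow>
      g ((1 - u) *\<^sub>R y + u *\<^sub>R z) \<le> ereal (1 - u) * g y + ereal u * g z)"

definition strictly_econvex_on :: "'a::real_vector set \<Rightarrow> ('a \<Rightarrow> ereal) \<Rightarrow> bool" where
  "strictly_econvex_on C g \<longleftrightarrow> (\<forall>y\<in>C. \<forall>z\<in>C. \<forall>u::real. y \<noteq> z \<and> 0 < u \<and> u < 1 \<longrightarrow>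
      g ((1 - u) *\<^sub>R y + u *\<^sub>R z) < ereal (1 - u) * g y + ereal u * g z)"

definition subdifferential :: "('a::real_inner \<Rightarrow> ereal) \<Rightarrow> 'a \<Rightarrow> 'a set" where
  "subdifferential g y =
     {s. \<bar>g y\<bar> \<noteq> \<infinity> \<and> (\<forall>z. g y + ereal ((z - y) \<bullet> s) \<le> g z)}"

definition Gamma :: "('a::euclidean_space \<Rightarrow> ereal) set" where
  "Gamma = {g. proper g \<and> econvex g \<and> lower_semicont g}"

text \<open>Derivatives of a proper \<open>g\<close> at points of the interior of its domain, where \<open>g\<close> is finite,
  are those of \<open>\<lambda>y. real_of_ereal (g y)\<close>.\<close>

definition essentially_smooth :: "('a::euclidean_space \<Rightarrow> ereal) \<Rightarrow> bool" where
  "essentially_smooth g \<longleftrightarrow>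
     interior (edom g) \<noteq> {} \<and>
     (\<forall>y\<in>interior (edom g). (\<lambda>z. real_of_ereal (g z)) differentiable (at y)) \<and>
     (\<forall>Y y. (\<forall>k::nat. Y k \<in> interior (edom g)) \<and> Y \<longlonglongrightarrow> y \<and> y \<in> frontier (interior (edom g)) \<longrightarrow>
        filterlim (\<lambda>k. norm (gradient (\<lambda>z. real_of_ereal (g z)) (Y k))) at_top sequentially)"

definition essentially_strictly_convex :: "('a::euclidean_space \<Rightarrow> ereal) \<Rightarrow> bool" where
  "essentially_strictly_convex g \<longleftrightarrow>
     (\<forall>C. convex C \<and> C \<subseteq> {y. subdifferential g y \<noteq> {}} \<longrightarrow> strictly_econvex_on C g)"

definition Gamma_sc :: "('a::euclidean_space \<Rightarrow> ereal) set" where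
  "Gamma_sc = {g \<in> Gamma. essentially_smooth g \<and> essentially_strictly_convex g}"

definition Gamma_sc2 :: "(real^'m \<Rightarrow> ereal) set" where
  "Gamma_sc2 = {g \<in> Gamma_sc. \<forall>y\<in>interior (edom g).
      gradient (\<lambda>z. real_of_ereal (g z)) differentiable (at y) \<and>
      pos_definite (hessian (\<lambda>z. real_of_ereal (g z)) y)}"


section \<open>The primal and dual problems\<close>

text \<open>The index set \<open>{0,\<dots>,m}\<close> is the type \<open>'m option\<close>: \<open>None\<close> is the index \<open>0\<close> and
  the \<open>Some i\<close> are the indices \<open>1,\<dots>,m\<close>.\<close>

definition quad :: "real^'n^'n \<Rightarrow> real^'n \<Rightarrow> real \<Rightarrow> real^'n \<Rightarrow> real" where
  "quad M v r x = 1/2 * (x \<bullet> (M *v x)) - v \<bullet> x + r"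

definition qvec :: "('m option \<Rightarrow> real^'n^'n) \<Rightarrow> ('m option \<Rightarrow> real^'n) \<Rightarrow> ('m option \<Rightarrow> real)
    \<Rightarrow> real^'n \<Rightarrow> real^'m" where
  "qvec A b c x = (\<chi> i. quad (A (Some i)) (b (Some i)) (c (Some i)) x)"

definition primal :: "(real^'m \<Rightarrow> ereal) \<Rightarrow> ('m option \<Rightarrow> real^'n^'n) \<Rightarrow> ('m option \<Rightarrow> real^'n)
    \<Rightarrow> ('m option \<Rightarrow> real) \<Rightarrow> real^'n \<Rightarrow> ereal" where
  "primal V A b c x = ereal (quad (A None) (b None) (c None) x) + V (qvec A b c x)"

definition X0 :: "(real^'m \<Rightarrow> ereal) \<Rightarrow> ('m option \<Rightarrow> real^'n^'n) \<Rightarrow> ('m option \<Rightarrow> real^'n)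
    \<Rightarrow> ('m option \<Rightarrow> real) \<Rightarrow> (real^'n) set" where
  "X0 V A b c = {x. qvec A b c x \<in> interior (edom V)}"

definition coef :: "real^'m \<Rightarrow> 'm option \<Rightarrow> real" where
  "coef \<sigma> k = (case k of None \<Rightarrow> 1 | Some i \<Rightarrow> \<sigma> $ i)"

definition lincomb :: "('m::finite option \<Rightarrow> 'a::real_vector) \<Rightarrow> real^'m \<Rightarrow> 'a" where
  "lincomb a \<sigma> = (\<Sum>k\<in>UNIV. coef \<sigma> k *\<^sub>R a k)"

definition Xi :: "(real^'m \<Rightarrow> ereal) \<Rightarrow> ('m option \<Rightarrow> real^'n^'n) \<Rightarrow> ('m option \<Rightarrow> real^'n)
    \<Rightarrow> ('m option \<Rightarrow> real) \<Rightarrow> real^'n \<Rightarrow> real^'m \<Rightarrow> ereal" where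
  "Xi V A b c x \<sigma> =
     ereal (quad (A None) (b None) (c None) x + qvec A b c x \<bullet> \<sigma>) - fenchel_conj V \<sigma>"

definition critical_point_Xi :: "(real^'m \<Rightarrow> ereal) \<Rightarrow> ('m option \<Rightarrow> real^'n^'n)
    \<Rightarrow> ('m option \<Rightarrow> real^'n) \<Rightarrow> ('m option \<Rightarrow> real) \<Rightarrow> real^'n \<Rightarrow> real^'m \<Rightarrow> bool" where
  "critical_point_Xi V A b c x \<sigma> \<longleftrightarrow>
     \<sigma> \<in> interior (edom (fenchel_conj V)) \<and>
     (GDERIV (\<lambda>(y, \<tau>). real_of_ereal (Xi V A b c y \<tau>)) (x, \<sigma>) :> 0)"

definition S_col :: "(real^'m \<Rightarrow> ereal) \<Rightarrow> ('m option \<Rightarrow> real^'n^'n) \<Rightarrow> ('m option \<Rightarrow> real^'n)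
    \<Rightarrow> (real^'m) set" where
  "S_col V A b = {\<sigma> \<in> edom (fenchel_conj V). lincomb b \<sigma> \<in> range ((*v) (lincomb A \<sigma>))}"

definition S_neg :: "(real^'m \<Rightarrow> ereal) \<Rightarrow> ('m option \<Rightarrow> real^'n^'n) \<Rightarrow> (real^'m) set" where
  "S_neg V A = {\<sigma> \<in> edom (fenchel_conj V). neg_definite (lincomb A \<sigma>)}"

text \<open>For proper \<open>V\<close> the conjugate is finite on its domain, so \<open>Xi\<close> is finite there; the
  choice of \<open>x\<close> is immaterial by \<open>dual_eq\<close> below.\<close>

definition dual :: "(real^'m \<Rightarrow> ereal) \<Rightarrow> ('m option \<Rightarrow> real^'n^'n) \<Rightarrow> ('m option \<Rightarrow> real^'n)
    \<Rightarrow> ('m option \<Rightarrow> real) \<Rightarrow> real^'m \<Rightarrow> real" where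
  "dual V A b c \<sigma> =
     real_of_ereal (Xi V A b c (SOME x. lincomb A \<sigma> *v x = lincomb b \<sigma>) \<sigma>)"

lemma lincomb_eq: "lincomb a \<sigma> = a None + (\<Sum>i\<in>UNIV. (\<sigma> $ i) *\<^sub>R a (Some i))"
  by (simp add: lincomb_def coef_def UNIV_option_conv sum.reindex)

lemma transpose_lincomb:
  assumes "\<And>k. transpose (A k) = A k"
  shows "transpose (lincomb A \<sigma>) = lincomb A \<sigma>"
proof -
  have "A k $ i $ j = A k $ j $ i" for k i j
    using arg_cong[OF assms[of k], of "\<lambda>M. M $ j $ i"] by (simp add: transpose_def)
  then show ?thesis
    by (simp add: lincomb_def transpose_def vec_eq_iff)
qed

lemma Xi_eq:
  "Xi V A b c x \<sigma> =
     ereal (1/2 * (x \<bullet> (lincomb A \<sigma> *v x)) - lincomb b \<sigma> \<bullet> x + lincomb c \<sigma>) - fenchel_conj V \<sigma>"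
proof -
  have mv: "lincomb A \<sigma> *v x = A None *v x + (\<Sum>i\<in>UNIV. (\<sigma> $ i) *\<^sub>R (A (Some i) *v x))"
  proof -
    have "(\<Sum>i\<in>I. (\<sigma> $ i) *\<^sub>R A (Some i)) *v x = (\<Sum>i\<in>I. (\<sigma> $ i) *\<^sub>R (A (Some i) *v x))"
      if "finite I" for I
      using that
      by (induction I) (auto simp: matrix_vector_mult_add_rdistrib scaleR_matrix_vector_assoc)
    then show ?thesis
      by (simp add: lincomb_eq matrix_vector_mult_add_rdistrib)
  qed
  have "qvec A b c x \<bullet> \<sigma> = (\<Sum>i\<in>UNIV. \<sigma> $ i * quad (A (Some i)) (b (Some i)) (c (Some i)) x)"
    by (simp add: qvec_def inner_vec_def mult.commute)
  also have "\<dots> = (\<Sum>i\<in>UNIV. 1/2 * (\<sigma> $ i * (x \<bullet> (A (Some i) *v x)))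
      - \<sigma> $ i * (b (Some i) \<bullet> x) + \<sigma> $ i * c (Some i))"
    by (rule sum.cong) (auto simp: quad_def algebra_simps)
  also have "\<dots> = 1/2 * (\<Sum>i\<in>UNIV. \<sigma> $ i * (x \<bullet> (A (Some i) *v x)))
      - (\<Sum>i\<in>UNIV. \<sigma> $ i * (b (Some i) \<bullet> x)) + (\<Sum>i\<in>UNIV. \<sigma> $ i * c (Some i))"
    by (simp only: sum.distrib sum_subtractf sum_distrib_left)
  finally have q: "qvec A b c x \<bullet> \<sigma> = \<dots>" .
  have "x \<bullet> (lincomb A \<sigma> *v x) = x \<bullet> (A None *v x) + (\<Sum>i\<in>UNIV. \<sigma> $ i * (x \<bullet> (A (Some i) *v x)))"
    "lincomb b \<sigma> \<bullet> x = b None \<bullet> x + (\<Sum>i\<in>UNIV. \<sigma> $ i * (b (Some i) \<bullet> x))"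
    "lincomb c \<sigma> = c None + (\<Sum>i\<in>UNIV. \<sigma> $ i * c (Some i))"
    unfolding mv
    by (simp_all only: lincomb_eq inner_add_right inner_add_left inner_sum_right inner_sum_left
        inner_scaleR_right inner_scaleR_left real_scaleR_def)
  then have "quad (A None) (b None) (c None) x + qvec A b c x \<bullet> \<sigma> =
      1/2 * (x \<bullet> (lincomb A \<sigma> *v x)) - lincomb b \<sigma> \<bullet> x + lincomb c \<sigma>"
    unfolding q quad_def by argo
  then show ?thesis
    unfolding Xi_def by (simp only:)
qed

lemma dual_eq:
  assumes sym: "\<And>k. transpose (A k) = A k"
    and x: "lincomb A \<sigma> *v x = lincomb b \<sigma>"
  shows "dual V A b c \<sigma> = real_of_ereal (Xi V A b c x \<sigma>)"
proof -
  define y where "y = (SOME x. lincomb A \<sigma> *v x = lincomb b \<sigma>)"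
  have y: "lincomb A \<sigma> *v y = lincomb b \<sigma>"
    unfolding y_def using x by (rule someI)
  have "y \<bullet> (lincomb A \<sigma> *v x) = x \<bullet> (lincomb A \<sigma> *v y)"
    using dot_lmul_matrix[of y "lincomb A \<sigma>" x] transpose_matrix_vector[of "lincomb A \<sigma>" y]
    by (simp add: transpose_lincomb[OF sym] inner_commute)
  then have "y \<bullet> lincomb b \<sigma> = x \<bullet> lincomb b \<sigma>"
    using x y by simp
  then show ?thesis
    unfolding dual_def y_def[symmetric] Xi_eq x y by (simp add: inner_commute)
qed

end

theory Submission
  imports Defs
begin

text \<open>Both equivalences are second-order tests. With \<open>G\<close> the matrix with columns \<open>A\<^sub>i x - b\<^sub>i\<close>, one has
  \<open>H = (E\<^sup>-\<^sup>1)\<^sup>* G F\<^sup>*\<close>, and \<open>\<nabla>\<^sup>2f(x) = A(\<sigma>) + G F\<^sup>* F G\<^sup>* = E\<^sup>* (H H\<^sup>* - I) E\<close>, while \<open>D\<close> has at the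
  critical point \<open>\<sigma>\<close> a second-order expansion with quadratic form
  \<open>- G\<^sup>* A(\<sigma>)\<^sup>-\<^sup>1 G - (F\<^sup>* F)\<^sup>-\<^sup>1 = F\<^sup>-\<^sup>1 (H\<^sup>* H - I) (F\<^sup>-\<^sup>1)\<^sup>*\<close>. Non-degeneracy of the first form passes
  to the second, and \<open>H\<close> is a strict contraction (for \<open>m = n\<close>: a strict expansion) iff \<open>H\<^sup>*\<close> is.

  The expansion of \<open>V\<^sup>*\<close> at \<open>\<sigma>\<close> is read off directly from that of \<open>V\<close> at \<open>q(x)\<close>: near \<open>q(x)\<close> the
  supremum defining \<open>V\<^sup>*\<close> is that of a perturbed quadratic, and convexity makes distant points
  irrelevant.\<close>

section \<open>Second-order expansions\<close>

text \<open>Expansion with Peano remainder \<open>o(|h|^2)\<close> at the single point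
  \<open>x\<close>. It does not mention derivatives near \<open>x\<close>, so it can be established
  for the conjugate and the dual function without differentiating them twice.\<close>

definition has_taylor2 :: "('a::real_inner \<Rightarrow> real) \<Rightarrow> 'a \<Rightarrow> 'a \<Rightarrow> ('a \<Rightarrow> 'a) \<Rightarrow> bool" where
  "has_taylor2 f x g L \<longleftrightarrow> (\<forall>e>0. \<forall>\<^sub>F h in nhds 0.
     \<bar>f (x + h) - f x - g \<bullet> h - (h \<bullet> L h) / 2\<bar> \<le> e * (norm h)\<^sup>2)"

text \<open>The mean value theorem for \<open>f\<close> along the segment minus its quadratic model
  turns the remainder into the first-order remainder of \<open>g\<close> at an intermediate point,
  paired with \<open>h\<close>. Hence differentiability of \<open>g\<close> at the one point
  \<open>x\<close> is enough.\<close>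

lemma has_taylor2_gradient:
  fixes f :: "'a::real_inner \<Rightarrow> real"
  assumes gr: "\<forall>\<^sub>F y in nhds x. GDERIV f y :> g y" and L: "(g has_derivative L) (at x)"
  shows "has_taylor2 f x (g x) L"
  unfolding has_taylor2_def
proof (intro allI impI)
  fix e :: real assume "e > 0"
  interpret L: bounded_linear L using L by (rule has_derivative_bounded_linear)
  obtain r where r: "r > 0" "\<And>y. dist y x < r \<Longrightarrow> GDERIV f y :> g y"
    using gr unfolding eventually_nhds_metric by blast
  obtain s where s: "s > 0" "\<And>y. norm (y - x) < s \<Longrightarrow> norm (g y - g x - L (y - x)) \<le> e * norm (y - x)"
    using L \<open>e > 0\<close> unfolding has_derivative_at_alt by blast
  have "\<bar>f (x + h) - f x - g x \<bullet> h - (h \<bullet> L h) / 2\<bar> \<le> e * (norm h)\<^sup>2" if h: "dist h 0 < min r s" for h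
  proof -
    define p where "p t = f (x + t *\<^sub>R h) - t * (g x \<bullet> h) - t\<^sup>2 / 2 * (h \<bullet> L h)" for t
    define p' where "p' t = g (x + t *\<^sub>R h) \<bullet> h - g x \<bullet> h - t * (h \<bullet> L h)" for t
    have small: "norm (t *\<^sub>R h) \<le> norm h" if "0 \<le> t" "t \<le> 1" for t
      using that by (simp add: mult_left_le_one_le)
    have "(p has_real_derivative p' t) (at t)" if t: "0 \<le> t" "t \<le> 1" for t
    proof -
      have "GDERIV f (x + t *\<^sub>R h) :> g (x + t *\<^sub>R h)"
        using r(2)[of "x + t *\<^sub>R h"] small[OF t] h by (simp add: dist_norm)
      then have "(f has_derivative (\<lambda>k. k \<bullet> g (x + t *\<^sub>R h))) (at (x + t *\<^sub>R h))"
        by (simp add: gderiv_def)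
      then have "((\<lambda>t. f (x + t *\<^sub>R h)) has_derivative (\<lambda>k. (k *\<^sub>R h) \<bullet> g (x + t *\<^sub>R h))) (at t)"
        by (rule has_derivative_compose[rotated]) (auto intro!: derivative_eq_intros)
      then have "((\<lambda>t. f (x + t *\<^sub>R h)) has_real_derivative (g (x + t *\<^sub>R h) \<bullet> h)) (at t)"
        by (rule has_derivative_imp_has_field_derivative) (simp add: inner_commute mult.commute)
      then show ?thesis
        unfolding p_def p'_def by (auto intro!: derivative_eq_intros)
    qed
    then have "\<exists>z::real. 0 < z \<and> z < 1 \<and> p 1 - p 0 = (1 - 0) * p' z"
      by (intro MVT2) auto
    then obtain z where z: "0 < z" "z < 1" "p 1 - p 0 = p' z" by auto
    have "p' z = (g (x + z *\<^sub>R h) - g x - L (x + z *\<^sub>R h - x)) \<bullet> h"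
      by (simp add: p'_def L.scaleR inner_commute[of _ h] inner_diff_right)
    also have "\<bar>\<dots>\<bar> \<le> norm (g (x + z *\<^sub>R h) - g x - L (x + z *\<^sub>R h - x)) * norm h"
      by (rule Cauchy_Schwarz_ineq2)
    also have "\<dots> \<le> (e * norm (z *\<^sub>R h)) * norm h"
      using s(2)[of "x + z *\<^sub>R h"] small[of z] z h
      by (intro mult_right_mono) (auto simp: dist_norm)
    also have "\<dots> \<le> (e * norm h) * norm h"
      using small[of z] z \<open>e > 0\<close> by (intro mult_right_mono mult_left_mono) auto
    finally show ?thesis
      using z by (simp add: p_def power2_eq_square)
  qed
  then show "\<forall>\<^sub>F h in nhds 0. \<bar>f (x + h) - f x - g x \<bullet> h - (h \<bullet> L h) / 2\<bar> \<le> e * (norm h)\<^sup>2"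
    unfolding eventually_nhds_metric using r(1) s(1) by (intro exI[of _ "min r s"]) auto
qed

lemma has_taylor2_minus:
  "has_taylor2 f x g L \<Longrightarrow> has_taylor2 (\<lambda>y. - f y) x (- g) (\<lambda>h. - L h)"
  unfolding has_taylor2_def
  by (elim all_forward imp_forward eventually_mono) (auto simp: abs_le_iff)

lemma eventually_nhds_shift:
  fixes x :: "'a::real_normed_vector"
  shows "(\<forall>\<^sub>F y in nhds x. P y) \<longleftrightarrow> (\<forall>\<^sub>F h in nhds 0. P (x + h))"
proof -
  have "nhds x = filtermap (\<lambda>h. x + h) (nhds 0)"
    using filtermap_nhds_shift[of "- x" 0] by (simp add: add.commute)
  then show ?thesis by (simp add: eventually_filtermap)
qed

text \<open>The form attains a positive minimum on the compact unit sphere; homogeneity of degree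
  two extends the bound to all \<open>h\<close>.\<close>

lemma definite_quadratic_lower_bound:
  fixes L :: "'a::euclidean_space \<Rightarrow> 'a"
  assumes lin: "linear L" and pos: "\<And>h. h \<noteq> 0 \<Longrightarrow> h \<bullet> L h > 0"
  obtains l where "l > 0" "\<And>h. l * (norm h)\<^sup>2 \<le> h \<bullet> L h"
proof -
  interpret linear L by fact
  have "compact (sphere 0 1 :: 'a set)" "sphere 0 1 \<noteq> ({} :: 'a set)" by auto
  moreover have "continuous_on (sphere 0 1) (\<lambda>h. h \<bullet> L h)"
    by (intro continuous_intros linear_continuous_on) (use lin in \<open>simp add: linear_linear\<close>)
  ultimately obtain k where k: "k \<in> sphere 0 1" "\<And>h. h \<in> sphere 0 1 \<Longrightarrow> k \<bullet> L k \<le> h \<bullet> L h"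
    using continuous_attains_inf[of "sphere 0 1" "\<lambda>h. h \<bullet> L h"] by blast
  have "(k \<bullet> L k) * (norm h)\<^sup>2 \<le> h \<bullet> L h" for h
  proof (cases "h = 0")
    case False
    then have "k \<bullet> L k \<le> (h /\<^sub>R norm h) \<bullet> L (h /\<^sub>R norm h)"
      by (intro k) simp
    also have "\<dots> = (h \<bullet> L h) / (norm h)\<^sup>2"
      by (simp add: scale power2_eq_square divide_simps)
    finally show ?thesis using False by (simp add: divide_simps)
  qed (use scale[of 0 0] in simp)
  moreover have "k \<bullet> L k > 0" using k(1) by (intro pos) auto
  ultimately show thesis using that by blast
qed

text \<open>If the form vanished at \<open>h\<close>, moving in the direction
  \<open>k = L h \<noteq> 0\<close> would change it by \<open>2 t |k|^2 + O(t^2)\<close>, which is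
  positive for small \<open>t > 0\<close>.\<close>

lemma semidefinite_inj_imp_definite:
  fixes L :: "'a::real_inner \<Rightarrow> 'a"
  assumes lin: "linear L" and sym: "\<And>h k. L h \<bullet> k = h \<bullet> L k"
    and nonpos: "\<And>h. h \<bullet> L h \<le> 0" and inj: "\<And>h. L h = 0 \<Longrightarrow> h = 0" and "h \<noteq> 0"
  shows "h \<bullet> L h < 0"
proof (rule ccontr)
  interpret linear L by fact
  assume "\<not> h \<bullet> L h < 0"
  then have zero: "h \<bullet> L h = 0" using nonpos[of h] by simp
  define k where "k = L h"
  \<comment> \<open>The \<open>+ 1\<close> keeps \<open>a\<close> positive. With
    \<open>t = k \<bullet> k / a\<close> the second-order term \<open>t * (k \<bullet> L k)\<close>
    is at least \<open>- (k \<bullet> k)\<close>, so it cannot cancel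
    \<open>2 * (k \<bullet> k)\<close>.\<close>
  define a where "a = \<bar>k \<bullet> L k\<bar> + 1"
  define t where "t = k \<bullet> k / a"
  have "k \<bullet> k > 0" using inj \<open>h \<noteq> 0\<close> by (auto simp: k_def)
  have a: "a > 0" by (simp add: a_def)
  then have t: "t > 0" using \<open>k \<bullet> k > 0\<close> by (simp add: t_def)
  have "(h + t *\<^sub>R k) \<bullet> L (h + t *\<^sub>R k) = t * (2 * (k \<bullet> k) + t * (k \<bullet> L k))"
    using sym[of h k] zero by (simp add: add scale inner_add algebra_simps flip: k_def)
  then have "t * (2 * (k \<bullet> k) + t * (k \<bullet> L k)) \<le> 0"
    using nonpos[of "h + t *\<^sub>R k"] by simp
  then have "2 * (k \<bullet> k) + t * (k \<bullet> L k) \<le> 0"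
    using t by (simp add: mult_le_0_iff)
  moreover have "t * (k \<bullet> L k) \<ge> - (t * a)"
    using mult_left_mono[of "- a" "k \<bullet> L k" t] t unfolding a_def by linarith
  moreover have "t * a = k \<bullet> k" using a by (simp add: t_def)
  ultimately show False using \<open>k \<bullet> k > 0\<close> by simp
qed

text \<open>A local maximum forces a semidefinite form, by scaling each direction into the small
  ball, and injectivity of \<open>L\<close> upgrades this to definiteness. Conversely a definite
  form dominates the remainder.\<close>

lemma has_taylor2_local_max_iff:
  fixes f :: "'a::euclidean_space \<Rightarrow> real"
  assumes f: "has_taylor2 f x 0 L" and lin: "linear L"
    and sym: "\<And>h k. L h \<bullet> k = h \<bullet> L k" and inj: "\<And>h. L h = 0 \<Longrightarrow> h = 0"
  shows "(\<forall>\<^sub>F y in nhds x. f y \<le> f x) \<longleftrightarrow> (\<forall>h. h \<noteq> 0 \<longrightarrow> h \<bullet> L h < 0)"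
proof
  interpret linear L by fact
  assume "\<forall>\<^sub>F y in nhds x. f y \<le> f x"
  then have ev: "\<forall>\<^sub>F h in nhds 0. f (x + h) \<le> f x" by (simp add: eventually_nhds_shift[of _ x])
  have "h \<bullet> L h \<le> 0" for h
  proof (cases "h = 0")
    case False
    have "h \<bullet> L h \<le> 0 + e" if "e > 0" for e
    proof -
      \<comment> \<open>Normalized so that for \<open>k = t *\<^sub>R h\<close> the error
        \<open>2 * e' * (norm k)\<^sup>2\<close> equals \<open>t\<^sup>2 * e\<close>, after which
        \<open>t\<^sup>2\<close> cancels.\<close>
      define e' where "e' = e / (2 * (norm h)\<^sup>2)"
      have "e' > 0" using that False by (simp add: e'_def)
      then have "\<forall>\<^sub>F k in nhds 0. \<bar>f (x + k) - f x - (k \<bullet> L k) / 2\<bar> \<le> e' * (norm k)\<^sup>2"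
        using f by (simp add: has_taylor2_def)
      with ev have "\<forall>\<^sub>F k in nhds 0. (k \<bullet> L k) \<le> 2 * e' * (norm k)\<^sup>2"
        by eventually_elim (simp add: abs_le_iff)
      then obtain d where d: "d > 0" "\<And>k. norm k < d \<Longrightarrow> (k \<bullet> L k) \<le> 2 * e' * (norm k)\<^sup>2"
        unfolding eventually_nhds_metric by (auto simp: dist_norm)
      define t where "t = d / (2 * norm h)"
      have t: "t > 0" "norm (t *\<^sub>R h) < d" using d False by (auto simp: t_def)
      have "t\<^sup>2 * (h \<bullet> L h) \<le> t\<^sup>2 * e"
        using d(2)[OF t(2)] False by (simp add: scale e'_def power_mult_distrib power2_eq_square mult_ac)
      then show ?thesis using t by simp
    qed
    then show ?thesis by (rule field_le_epsilon)
  qed simp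
  then show "\<forall>h. h \<noteq> 0 \<longrightarrow> h \<bullet> L h < 0"
    using semidefinite_inj_imp_definite[OF lin sym _ inj] by blast
next
  assume neg: "\<forall>h. h \<noteq> 0 \<longrightarrow> h \<bullet> L h < 0"
  have "linear (\<lambda>h. - L h)" using lin by (rule linear_compose_neg)
  moreover have "h \<bullet> - L h > 0" if "h \<noteq> 0" for h using neg that by simp
  ultimately obtain l where l: "l > 0" "\<And>h. l * (norm h)\<^sup>2 \<le> h \<bullet> - L h"
    using definite_quadratic_lower_bound[of "\<lambda>h. - L h"] by blast
  \<comment> \<open>The error rate \<open>l/2\<close> is exactly what half of the form, at most
    \<open>- l/2 * (norm h)\<^sup>2\<close>, can absorb.\<close>
  have "\<forall>\<^sub>F h in nhds 0. \<bar>f (x + h) - f x - 0 \<bullet> h - (h \<bullet> L h) / 2\<bar> \<le> l/2 * (norm h)\<^sup>2"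
    using f l(1) unfolding has_taylor2_def by (auto dest: spec[of _ "l / 2"])
  then have "\<forall>\<^sub>F h in nhds 0. f (x + h) \<le> f x"
  proof eventually_elim
    case (elim h)
    then show ?case using l(2)[of h] unfolding inner_zero_left inner_minus_right by linarith
  qed
  then show "\<forall>\<^sub>F y in nhds x. f y \<le> f x" by (simp add: eventually_nhds_shift[of _ x])
qed

lemma has_taylor2_local_min_iff:
  fixes f :: "'a::euclidean_space \<Rightarrow> real"
  assumes "has_taylor2 f x 0 L" and "linear L"
    and "\<And>h k. L h \<bullet> k = h \<bullet> L k" and "\<And>h. L h = 0 \<Longrightarrow> h = 0"
  shows "(\<forall>\<^sub>F y in nhds x. f x \<le> f y) \<longleftrightarrow> (\<forall>h. h \<noteq> 0 \<longrightarrow> h \<bullet> L h > 0)"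
  using has_taylor2_local_max_iff[of "\<lambda>y. - f y" x "\<lambda>h. - L h"]
    has_taylor2_minus[OF assms(1)] linear_compose_neg[OF assms(2)] assms(3,4) by simp

section \<open>Expansion of the Fenchel conjugate\<close>

text \<open>By convexity the difference quotients along the segment from \<open>y\<close> to
  \<open>z\<close> are at most \<open>g z - g y\<close> for \<open>0 < u < 1\<close>; their limit
  from the right at 0 is the directional derivative. An infinite \<open>g z\<close> is
  trivial.\<close>

lemma econvex_gradient_inequality:
  fixes g :: "'a::euclidean_space \<Rightarrow> ereal"
  assumes conv: "econvex g" and low: "\<And>y. g y > -\<infinity>" and y: "g y < \<infinity>"
    and gr: "GDERIV (\<lambda>z. real_of_ereal (g z)) y :> s"
  shows "g y + ereal ((z - y) \<bullet> s) \<le> g z"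
proof (cases "g z")
  case (real c)
  define r where "r = (\<lambda>z. real_of_ereal (g z))"
  have gy: "g y = ereal (r y)" using y low[of y] by (cases "g y") (auto simp: r_def)
  define p where "p u = r (y + u *\<^sub>R (z - y))" for u
  have "(p has_derivative (\<lambda>u. (u *\<^sub>R (z - y)) \<bullet> s)) (at 0)"
    unfolding p_def
  proof (rule has_derivative_compose[where f = "\<lambda>u. y + u *\<^sub>R (z - y)" and g = r])
    show "(r has_derivative (\<lambda>h. h \<bullet> s)) (at (y + 0 *\<^sub>R (z - y)))"
      using gr by (simp add: gderiv_def r_def)
  qed (auto intro!: derivative_eq_intros)
  then have "(p has_real_derivative ((z - y) \<bullet> s)) (at 0)"
    by (rule has_derivative_imp_has_field_derivative) (simp add: mult.commute)
  then have "((\<lambda>u. (p u - p 0) / u) \<longlongrightarrow> (z - y) \<bullet> s) (at_right 0)"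
    using tendsto_mono[OF at_le[of "{0<..}" UNIV "0::real"]] by (force simp: DERIV_def)
  moreover have "\<forall>\<^sub>F u in at_right 0. (p u - p 0) / u \<le> c - r y"
    unfolding eventually_at_right_field
  proof (intro exI[of _ 1] conjI allI impI)
    fix u :: real assume u: "0 < u" "u < 1"
    have "g (y + u *\<^sub>R (z - y)) = g ((1 - u) *\<^sub>R y + u *\<^sub>R z)"
      by (simp add: algebra_simps)
    also have "\<dots> \<le> ereal (1 - u) * g y + ereal u * g z"
      using conv u by (simp add: econvex_def)
    finally have "g (y + u *\<^sub>R (z - y)) \<le> ereal ((1 - u) * r y + u * c)"
      by (simp add: gy real)
    then have "p u \<le> (1 - u) * r y + u * c"
      using low[of "y + u *\<^sub>R (z - y)"] by (cases "g (y + u *\<^sub>R (z - y))") (auto simp: p_def r_def)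
    then show "(p u - p 0) / u \<le> c - r y"
      using u by (simp add: p_def field_simps)
  qed simp
  ultimately have "(z - y) \<bullet> s \<le> c - r y"
    by (rule tendsto_upperbound) simp
  then show ?thesis by (simp add: gy real)
qed (use low[of z] in auto)

lemma fenchel_conj_upper: "ereal (y \<bullet> s) - V y \<le> fenchel_conj V s"
  unfolding fenchel_conj_def by (rule SUP_upper) simp

lemma fenchel_conj_gt_minf:
  assumes "proper V"
  shows "fenchel_conj V s > -\<infinity>"
proof -
  obtain y where "V y < \<infinity>" "V y > -\<infinity>" using assms by (auto simp: proper_def edom_def)
  then have "ereal (y \<bullet> s) - V y > -\<infinity>" by (cases "V y") auto
  then show ?thesis using fenchel_conj_upper[of y s V] by (rule less_le_trans)
qed

text \<open>The conjugate is a supremum of functions affine in \<open>s\<close>; points with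
  \<open>V y = \<infinity>\<close> contribute only \<open>-\<infinity>\<close>.\<close>

lemma econvex_fenchel_conj:
  assumes "proper V"
  shows "econvex (fenchel_conj V)"
  unfolding econvex_def
proof (intro allI impI)
  fix s t and u :: real assume u: "0 < u \<and> u < 1"
  show "fenchel_conj V ((1 - u) *\<^sub>R s + u *\<^sub>R t) \<le> ereal (1 - u) * fenchel_conj V s + ereal u * fenchel_conj V t"
    unfolding fenchel_conj_def[of V "(1 - u) *\<^sub>R s + u *\<^sub>R t"]
  proof (rule SUP_least)
    fix y
    show "ereal (y \<bullet> ((1 - u) *\<^sub>R s + u *\<^sub>R t)) - V y \<le> ereal (1 - u) * fenchel_conj V s + ereal u * fenchel_conj V t"
    proof (cases "V y")
      case (real v)
      have "ereal (y \<bullet> s - v) \<le> fenchel_conj V s" "ereal (y \<bullet> t - v) \<le> fenchel_conj V t"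
        using fenchel_conj_upper[of y _ V] by (auto simp: real)
      then have "ereal (1 - u) * ereal (y \<bullet> s - v) + ereal u * ereal (y \<bullet> t - v)
          \<le> ereal (1 - u) * fenchel_conj V s + ereal u * fenchel_conj V t"
        using u by (intro add_mono ereal_mult_left_mono) auto
      then show ?thesis by (simp add: real inner_add_right algebra_simps)
    qed (use assms in \<open>auto simp: proper_def\<close>)
  qed
qed

text \<open>The gradient inequality of \<open>V\<close> at \<open>y\<close> bounds the conjugate at
  \<open>t\<close> from above, that of the conjugate at \<open>s\<close> bounds it from below.
  Together they yield equality in the Fenchel-Young inequality for \<open>y\<close> and
  \<open>s\<close>, so \<open>y\<close> minimizes \<open>V\<close> minus the linear function
  \<open>s\<close> and the stationarity condition is \<open>t = s\<close>.\<close>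

lemma gradient_conj_imp_gradient:
  fixes V :: "'a::euclidean_space \<Rightarrow> ereal"
  assumes V: "proper V" "econvex V" and y: "y \<in> interior (edom V)" and s: "s \<in> edom (fenchel_conj V)"
    and gV: "GDERIV (\<lambda>z. real_of_ereal (V z)) y :> t"
    and gC: "GDERIV (\<lambda>z. real_of_ereal (fenchel_conj V z)) s :> y"
  shows "t = s"
proof -
  have low: "V z > -\<infinity>" for z using V by (simp add: proper_def)
  define r where "r = (\<lambda>z. real_of_ereal (V z))"
  have r: "V z = ereal (r z)" if "z \<in> edom V" for z
    using that low[of z] by (cases "V z") (auto simp: r_def edom_def)
  have ye: "y \<in> edom V" using y interior_subset by blast
  obtain w where w: "fenchel_conj V s = ereal w"
    using s fenchel_conj_gt_minf[OF V(1), of s] by (cases "fenchel_conj V s") (auto simp: edom_def)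
  have "fenchel_conj V t \<le> ereal (y \<bullet> t - r y)"
    unfolding fenchel_conj_def
  proof (rule SUP_least)
    fix z
    have "ereal (r y) + ereal ((z - y) \<bullet> t) \<le> V z"
      using econvex_gradient_inequality[OF V(2) low _ gV, of z] ye r[OF ye] by (auto simp: edom_def)
    then show "ereal (z \<bullet> t) - V z \<le> ereal (y \<bullet> t - r y)"
      using low[of z] by (cases "V z") (auto simp: inner_diff_left)
  qed
  moreover have "ereal w + ereal ((t - s) \<bullet> y) \<le> fenchel_conj V t"
    using econvex_gradient_inequality[OF econvex_fenchel_conj[OF V(1)] fenchel_conj_gt_minf[OF V(1)] _ gC] w
    by simp
  ultimately have "ereal w + ereal ((t - s) \<bullet> y) \<le> ereal (y \<bullet> t - r y)" by (rule order_trans[rotated])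
  \<comment> \<open>The terms in \<open>t\<close> cancel; this is the nontrivial half of
    Fenchel-Young equality.\<close>
  then have wle: "w \<le> y \<bullet> s - r y" by (simp add: inner_commute[of y] inner_diff_left)
  have min: "r y - y \<bullet> s \<le> r z - z \<bullet> s" if "z \<in> edom V" for z
    using fenchel_conj_upper[of z s V] wle by (simp add: r[OF that] w)
  have "((\<lambda>z. r z - z \<bullet> s) has_derivative (\<lambda>h. h \<bullet> t - h \<bullet> s)) (at y)"
    using gV unfolding gderiv_def r_def by (auto intro!: derivative_eq_intros)
  then have "(\<lambda>h. h \<bullet> t - h \<bullet> s) = (\<lambda>h. 0)"
    by (rule differential_zero_maxmin[OF y open_interior])
      (use min interior_subset in blast)
  then have "(t - s) \<bullet> t - (t - s) \<bullet> s = 0" by meson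
  then show ?thesis by (simp flip: inner_diff_right)
qed

text \<open>\<open>R\<close> is the inverse of \<open>W\<close>. For the exact quadratic model, the
  supremum of \<open>k \<bullet> h - (k \<bullet> W k) / 2\<close> is attained at
  \<open>k = R h\<close> and equals \<open>(h \<bullet> R h) / 2\<close>. Inserting this
  \<open>k\<close> gives the lower bound; the upper bound completes the square for small
  \<open>k\<close> and uses convexity for large \<open>k\<close>.\<close>

lemma has_taylor2_fenchel_conj:
  fixes V :: "'a::euclidean_space \<Rightarrow> ereal"
  assumes V: "proper V" "econvex V" and y: "y \<in> interior (edom V)"
    and tay: "has_taylor2 (\<lambda>z. real_of_ereal (V z)) y s W"
    and W: "linear W" "\<And>h k. W h \<bullet> k = h \<bullet> W k" "\<And>h. h \<noteq> 0 \<Longrightarrow> h \<bullet> W h > 0"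
    and R: "linear R" "\<And>h. W (R h) = h"
  shows "has_taylor2 (\<lambda>z. real_of_ereal (fenchel_conj V z)) s y R"
  unfolding has_taylor2_def
proof (intro allI impI)
  fix e :: real assume "e > 0"
  interpret W: linear W by fact
  interpret R: linear R by fact
  define r where "r = (\<lambda>z. real_of_ereal (V z))"
  have low: "V z > -\<infinity>" for z using V by (simp add: proper_def)
  have r: "V z = ereal (r z)" if "z \<in> edom V" for z
    using that low[of z] by (cases "V z") (auto simp: r_def edom_def)
  obtain l where l: "l > 0" "\<And>h. l * (norm h)\<^sup>2 \<le> h \<bullet> W h"
    using definite_quadratic_lower_bound[OF W(1,3)] by blast
  obtain K where K: "K > 0" "\<And>h. norm (R h) \<le> K * norm h"
    using linear_bounded_pos[OF R(1)] by blast
  \<comment> \<open>The bound \<open>l / 4\<close> lets the form absorb the remainder of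
    \<open>V\<close>, both in the completed square and in the growth at radius \<open>d\<close>. The
    other bound turns the final error \<open>2 * e' * (norm (R h))\<^sup>2\<close> into at most
    \<open>e * (norm h)\<^sup>2\<close>.\<close>
  define e' where "e' = min (l / 4) (e / (2 * K\<^sup>2))"
  have e': "e' > 0" "e' \<le> l / 4" "2 * e' * K\<^sup>2 \<le> e"
    using l(1) K(1) \<open>e > 0\<close> by (auto simp: e'_def min_def field_simps)
  have "\<forall>\<^sub>F k in nhds 0. \<bar>r (y + k) - r y - s \<bullet> k - (k \<bullet> W k) / 2\<bar> \<le> e' * (norm k)\<^sup>2"
    using tay e'(1) by (simp add: has_taylor2_def r_def)
  moreover have "\<forall>\<^sub>F k in nhds 0. y + k \<in> edom V"
    using y eventually_nhds_shift[of "\<lambda>z. z \<in> edom V" y]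
    by (metis eventually_nhds interior_subset open_interior subset_iff)
  ultimately have "\<forall>\<^sub>F k in nhds 0. y + k \<in> edom V \<and>
      \<bar>r (y + k) - r y - s \<bullet> k - (k \<bullet> W k) / 2\<bar> \<le> e' * (norm k)\<^sup>2"
    by eventually_elim auto
  then obtain d0 where d0: "d0 > 0" "\<And>k. norm k < d0 \<Longrightarrow> y + k \<in> edom V \<and>
      \<bar>r (y + k) - r y - s \<bullet> k - (k \<bullet> W k) / 2\<bar> \<le> e' * (norm k)\<^sup>2"
    unfolding eventually_nhds_metric by (auto simp: dist_norm)
  \<comment> \<open>Halving makes the estimates available on a closed ball; points at distance
    exactly \<open>d\<close> are used below.\<close>
  define d where "d = d0 / 2"
  have d: "d > 0" "\<And>k. norm k \<le> d \<Longrightarrow> y + k \<in> edom V"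
    "\<And>k. norm k \<le> d \<Longrightarrow> \<bar>r (y + k) - r y - s \<bullet> k - (k \<bullet> W k) / 2\<bar> \<le> e' * (norm k)\<^sup>2"
    using d0 by (auto simp: d_def)
  have ye: "y \<in> edom V" using y interior_subset by blast
  \<comment> \<open>\<open>l * d / 4\<close> is the slope of the growth of \<open>V\<close> beyond
    radius \<open>d\<close>, so \<open>h\<close> cannot outweigh it there; \<open>d / K\<close>
    keeps \<open>R h\<close> within radius \<open>d\<close>.\<close>
  define \<rho> where "\<rho> = min (l * d / 4) (d / K)"
  have \<rho>: "\<rho> > 0" using l(1) d(1) K(1) by (simp add: \<rho>_def)
  have up: "fenchel_conj V (s + h) \<le> ereal (y \<bullet> (s + h) - r y + (h \<bullet> R h) / 2 + 2 * e' * (norm (R h))\<^sup>2)"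
    if h: "norm h < \<rho>" for h
    unfolding fenchel_conj_def
  proof (rule SUP_least)
    fix z
    define k where "k = z - y"
    define u where "u = R h"
    have hu: "h = W u" by (simp add: u_def R)
    have z: "z = y + k" by (simp add: k_def)
    show "ereal (z \<bullet> (s + h)) - V z \<le> ereal (y \<bullet> (s + h) - r y + (h \<bullet> R h) / 2 + 2 * e' * (norm (R h))\<^sup>2)"
    proof (cases "V z")
      case (real c)
      have "k \<bullet> h - (c - r y - s \<bullet> k) \<le> (u \<bullet> W u) / 2 + 2 * e' * (norm u)\<^sup>2"
      proof (cases "norm k \<le> d")
        case True
        have c: "c = r (y + k)" using d(2)[OF True] real by (simp add: z r)
        \<comment> \<open>Completing the square about the maximizer \<open>u\<close> of the
          quadratic model.\<close>
        have "(u \<bullet> W u) / 2 - ((k - u) \<bullet> W (k - u)) / 2 = k \<bullet> h - (k \<bullet> W k) / 2"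
          using W(2)[of u k] unfolding hu
          by (simp add: W.diff inner_diff inner_commute[of "W u"] field_simps)
        moreover have "c - r y - s \<bullet> k \<ge> (k \<bullet> W k) / 2 - e' * (norm k)\<^sup>2"
          using d(3)[OF True] unfolding c by linarith
        moreover have "(k - u) \<bullet> W (k - u) \<ge> 4 * (e' * (norm (k - u))\<^sup>2)"
          using l(2)[of "k - u"] mult_right_mono[of "4 * e'" l "(norm (k - u))\<^sup>2"] e'(2) by simp
        \<comment> \<open>The part of the error in \<open>k - u\<close> is absorbed by the square,
          the part in \<open>u\<close> remains as the error term.\<close>
        moreover have "e' * (norm k)\<^sup>2 \<le> e' * (2 * (norm (k - u))\<^sup>2 + 2 * (norm u)\<^sup>2)"
        proof (rule mult_left_mono)
          have "norm k \<le> norm (k - u) + norm u" using norm_triangle_ineq[of "k - u" u] by simp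
          then have "(norm k)\<^sup>2 \<le> (norm (k - u) + norm u)\<^sup>2" by (intro power_mono) auto
          also have "\<dots> \<le> 2 * (norm (k - u))\<^sup>2 + 2 * (norm u)\<^sup>2"
            using zero_le_power2[of "norm (k - u) - norm u"] by (simp add: power2_eq_square algebra_simps)
          finally show "(norm k)\<^sup>2 \<le> 2 * (norm (k - u))\<^sup>2 + 2 * (norm u)\<^sup>2" .
        qed (use e' in simp)
        ultimately show ?thesis unfolding distrib_left mult.left_commute[of e' 2] by linarith
      next
        case False
        \<comment> \<open>\<open>t\<close> pulls \<open>k\<close> back to the sphere of radius
          \<open>d\<close>. Convexity on the segment from \<open>y\<close> to \<open>z\<close> then
          propagates the growth found there, at a linear rate, out to \<open>z\<close>.\<close>
        define t where "t = d / norm k"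
        have "norm k > 0" using False d(1) by linarith
        then have t: "0 < t" "t < 1" "t * norm k = d" using False d(1) by (auto simp: t_def)
        have tk: "norm (t *\<^sub>R k) \<le> d" using t by simp
        have "V (y + t *\<^sub>R k) = V ((1 - t) *\<^sub>R y + t *\<^sub>R z)" by (simp add: z algebra_simps)
        also have "\<dots> \<le> ereal (1 - t) * V y + ereal t * V z"
          using V(2) t by (simp add: econvex_def)
        finally have "r (y + t *\<^sub>R k) \<le> (1 - t) * r y + t * c"
          by (simp add: r[OF d(2)[OF tk]] r[OF ye] real)
        moreover have "r (y + t *\<^sub>R k) - r y \<ge> t * (s \<bullet> k) + t * (l / 4 * (d * norm k))"
        proof -
          have "l / 4 * (norm (t *\<^sub>R k))\<^sup>2 \<le> ((t *\<^sub>R k) \<bullet> W (t *\<^sub>R k)) / 2 - e' * (norm (t *\<^sub>R k))\<^sup>2"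
            using l(2)[of "t *\<^sub>R k"] mult_right_mono[OF e'(2), of "(norm (t *\<^sub>R k))\<^sup>2"] by simp
          moreover have "(norm (t *\<^sub>R k))\<^sup>2 = t * (d * norm k)"
            using t by (simp add: power2_eq_square mult_ac)
          ultimately show ?thesis
            using d(3)[OF tk] by (simp add: abs_le_iff algebra_simps)
        qed
        ultimately have "t * (s \<bullet> k + l / 4 * (d * norm k)) \<le> t * (c - r y)"
          by (simp add: algebra_simps)
        then have "s \<bullet> k + l / 4 * (d * norm k) \<le> c - r y"
          using t(1) by simp
        moreover have "k \<bullet> h \<le> norm k * (l * d / 4)"
          using h by (intro order_trans[OF norm_cauchy_schwarz] mult_left_mono) (auto simp: \<rho>_def)
        moreover have "0 \<le> (u \<bullet> W u)" using l(2)[of u] l(1) by (smt (verit) mult_nonneg_nonneg zero_le_power2)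
        moreover have "0 \<le> 2 * e' * (norm u)\<^sup>2" using e' by simp
        ultimately show ?thesis by (simp add: algebra_simps)
      qed
      moreover have "h \<bullet> R h = u \<bullet> W u" by (simp add: hu[symmetric] inner_commute) (simp add: u_def)
      ultimately have "z \<bullet> (s + h) - c \<le> y \<bullet> (s + h) - r y + (h \<bullet> R h) / 2 + 2 * e' * (norm (R h))\<^sup>2"
        unfolding z u_def inner_add inner_commute[of s] by linarith
      then show ?thesis by (simp add: real)
    qed (use low[of z] in auto)
  qed
  \<comment> \<open>The supremum is bounded below by its term at \<open>y + R h\<close>.\<close>
  have dn: "ereal (y \<bullet> (s + h) - r y + (h \<bullet> R h) / 2 - e' * (norm (R h))\<^sup>2) \<le> fenchel_conj V (s + h)"
    if h: "norm h < \<rho>" for h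
  proof -
    have "norm (R h) \<le> K * (d / K)"
      using h K(1) by (intro order_trans[OF K(2)] mult_left_mono) (auto simp: \<rho>_def)
    then have u: "norm (R h) \<le> d" using K(1) by simp
    have "r (y + R h) \<le> r y + s \<bullet> R h + (R h \<bullet> h) / 2 + e' * (norm (R h))\<^sup>2"
      using d(3)[OF u] by (simp add: R(2))
    then have "ereal (y \<bullet> (s + h) - r y + (h \<bullet> R h) / 2 - e' * (norm (R h))\<^sup>2) \<le>
        ereal ((y + R h) \<bullet> (s + h)) - V (y + R h)"
      by (simp add: r[OF d(2)[OF u]] inner_add inner_commute[of s] inner_commute[of h] algebra_simps)
    then show ?thesis using fenchel_conj_upper by (rule order_trans)
  qed
  \<comment> \<open>At \<open>h = 0\<close> the two bounds coincide and determine the value of the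
    conjugate.\<close>
  have at: "fenchel_conj V s = ereal (y \<bullet> s - r y)"
    using up[of 0] dn[of 0] \<rho> by (simp add: R.zero)
  have "\<bar>real_of_ereal (fenchel_conj V (s + h)) - real_of_ereal (fenchel_conj V s) - y \<bullet> h - (h \<bullet> R h) / 2\<bar> \<le> e * (norm h)\<^sup>2"
    if h: "norm h < \<rho>" for h
  proof -
    obtain w where w: "fenchel_conj V (s + h) = ereal w"
      using up[OF h] dn[OF h] by (cases "fenchel_conj V (s + h)") auto
    have "2 * e' * (norm (R h))\<^sup>2 \<le> 2 * e' * (K * norm h)\<^sup>2"
      using K(2)[of h] e' by (intro mult_left_mono power_mono) auto
    also have "\<dots> \<le> e * (norm h)\<^sup>2"
      using mult_right_mono[OF e'(3), of "(norm h)\<^sup>2"] by (simp add: power_mult_distrib mult_ac)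
    finally have "2 * e' * (norm (R h))\<^sup>2 \<le> e * (norm h)\<^sup>2" .
    moreover have "0 \<le> e' * (norm (R h))\<^sup>2" using e' by simp
    ultimately show ?thesis
      using up[OF h] dn[OF h] by (simp add: w at inner_add_right abs_le_iff)
  qed
  then show "\<forall>\<^sub>F h in nhds 0. \<bar>real_of_ereal (fenchel_conj V (s + h)) - real_of_ereal (fenchel_conj V s)
      - y \<bullet> h - (h \<bullet> R h) / 2\<bar> \<le> e * (norm h)\<^sup>2"
    unfolding eventually_nhds_metric using \<rho> by (auto simp: dist_norm)
qed

section \<open>Gram matrices\<close>

lemma inner_matrix_vector_transpose:
  fixes M :: "real^'m^'n"
  shows "(M *v u) \<bullet> v = u \<bullet> (transpose M *v v)"
  by (metis dot_lmul_matrix inner_commute transpose_matrix_vector transpose_transpose)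

lemma matrix_vector_mult_minus_left: "(- M) *v u = - (M *v u)" for M :: "real^'m^'n"
  by (simp add: vec_eq_iff matrix_vector_mult_def sum_negf)

lemma matrix_vector_mult_minus_right: "M *v (- u) = - (M *v u)" for M :: "real^'m^'n"
  by (simp add: vec_eq_iff matrix_vector_mult_def sum_negf)

text \<open>With \<open>p\<close> the image of \<open>w\<close> under the transpose,
  \<open>|p|^2 = (M *v p) \<bullet> w < |p| |w|\<close> by Cauchy-Schwarz, and \<open>|p|\<close>
  cancels.\<close>

lemma norm_transpose_less:
  fixes M :: "real^'m^'n"
  assumes "\<And>v. v \<noteq> 0 \<Longrightarrow> norm (M *v v) < norm v" and "w \<noteq> 0"
  shows "norm (transpose M *v w) < norm w"
proof (cases "transpose M *v w = 0")
  case False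
  let ?p = "transpose M *v w"
  have "norm ?p * norm ?p = (M *v ?p) \<bullet> w"
    by (simp add: inner_matrix_vector_transpose flip: power2_eq_square power2_norm_eq_inner)
  also have "\<dots> \<le> norm (M *v ?p) * norm w" by (rule norm_cauchy_schwarz)
  also have "\<dots> < norm ?p * norm w" using assms False by (intro mult_strict_right_mono) auto
  finally show ?thesis using False by simp
qed (use assms in simp)

text \<open>Expansion makes \<open>M\<close> injective, hence surjective when the dimensions agree.
  Writing \<open>w = M *v v\<close>, Cauchy-Schwarz bounds \<open>|w|^2\<close> by
  \<open>|v|\<close> times the norm of the transposed image, and \<open>|v| < |w|\<close>.\<close>

lemma norm_transpose_greater:
  fixes M :: "real^'m^'n"
  assumes card: "CARD('m) = CARD('n)" and M: "\<And>v. v \<noteq> 0 \<Longrightarrow> norm (M *v v) > norm v" and "w \<noteq> 0"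
  shows "norm (transpose M *v w) > norm w"
proof -
  have "inj ((*v) M)"
  proof (rule linear_injective_0[THEN iffD2, rule_format])
    show "v = 0" if "M *v v = 0" for v using M[of v] that by (cases "v = 0") auto
  qed simp
  then have "surj ((*v) M)"
    using card by (intro linear_injective_imp_surjective) auto
  then obtain v where v: "w = M *v v" by auto
  then have "v \<noteq> 0" using \<open>w \<noteq> 0\<close> by auto
  have "norm w * norm w = v \<bullet> (transpose M *v w)"
    by (simp add: v inner_matrix_vector_transpose flip: power2_eq_square power2_norm_eq_inner)
      (simp add: power2_norm_eq_inner inner_matrix_vector_transpose)
  also have "\<dots> \<le> norm v * norm (transpose M *v w)" by (rule norm_cauchy_schwarz)
  finally have *: "norm w * norm w \<le> norm v * norm (transpose M *v w)" .
  moreover have "norm w * norm w > 0" using \<open>w \<noteq> 0\<close> by simp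
  ultimately have "norm (transpose M *v w) \<noteq> 0"
    by (metis mult_zero_right not_le)
  then have "norm v * norm (transpose M *v w) < norm w * norm (transpose M *v w)"
    using M[OF \<open>v \<noteq> 0\<close>] v by (intro mult_strict_right_mono) auto
  with * have "norm w * norm w < norm w * norm (transpose M *v w)" by linarith
  then show ?thesis using \<open>w \<noteq> 0\<close> by simp
qed

text \<open>The two products of \<open>M\<close> and its transpose share the eigenvalue 1: if
  \<open>w\<close> is fixed by one, \<open>M *v w\<close> is fixed by the other. This carries
  non-degeneracy from the primal to the dual form.\<close>

lemma transpose_Gram_fixed_points:
  fixes M :: "real^'m^'n"
  assumes "\<forall>v. M *v (transpose M *v v) = v \<longrightarrow> v = 0"
  shows "\<forall>w. transpose M *v (M *v w) = w \<longrightarrow> w = 0"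
proof (intro allI impI)
  fix w assume w: "transpose M *v (M *v w) = w"
  then have "M *v w = 0" using assms by metis
  then show "w = 0" using w by simp
qed

lemma norm_sphere_iff:
  fixes M :: "real^'m^'n"
  shows "(\<forall>v\<in>sphere 0 1. norm (M *v v) < 1) \<longleftrightarrow> (\<forall>v. v \<noteq> 0 \<longrightarrow> norm (M *v v) < norm v)"
    and "(\<forall>v\<in>sphere 0 1. norm (M *v v) > 1) \<longleftrightarrow> (\<forall>v. v \<noteq> 0 \<longrightarrow> norm (M *v v) > norm v)"
proof -
  have eq: "norm (M *v (v /\<^sub>R norm v)) = norm (M *v v) / norm v" for v
    by (simp add: matrix_vector_mult_scaleR divide_inverse mult.commute)
  have sph: "(\<forall>v\<in>sphere 0 1. P (norm (M *v v))) \<longleftrightarrow> (\<forall>v. v \<noteq> 0 \<longrightarrow> P (norm (M *v v) / norm v))" for P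
  proof (intro iffI ballI allI impI)
    fix v :: "real^'m" assume "\<forall>v\<in>sphere 0 1. P (norm (M *v v))" "v \<noteq> 0"
    then show "P (norm (M *v v) / norm v)" by (subst eq[symmetric]) (auto simp del: matrix_vector_mult_scaleR)
  next
    fix v :: "real^'m" assume "\<forall>v. v \<noteq> 0 \<longrightarrow> P (norm (M *v v) / norm v)" "v \<in> sphere 0 1"
    then show "P (norm (M *v v))" by (metis div_by_1 mem_sphere_0 norm_zero zero_neq_one)
  qed
  show "(\<forall>v\<in>sphere 0 1. norm (M *v v) < 1) \<longleftrightarrow> (\<forall>v. v \<noteq> 0 \<longrightarrow> norm (M *v v) < norm v)"
    by (subst sph) (simp add: field_simps)
  show "(\<forall>v\<in>sphere 0 1. norm (M *v v) > 1) \<longleftrightarrow> (\<forall>v. v \<noteq> 0 \<longrightarrow> norm (M *v v) > norm v)"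
    by (subst sph) (simp add: field_simps)
qed

text \<open>The common core of both tests. The quadratic form at \<open>u\<close> is
  \<open>|M S u|^2 - |S u|^2\<close>, and \<open>S\<close> is a bijection, so its sign depends on
  \<open>M\<close> alone. The fixed-point hypothesis says that the form is non-degenerate.\<close>

lemma has_taylor2_Gram_extremum_iff:
  fixes f :: "real^'k \<Rightarrow> real" and M :: "real^'k^'j" and S T :: "real^'k^'k"
  assumes f: "has_taylor2 f x 0 L"
    and L: "\<And>u. L u = transpose S *v (transpose M *v (M *v (S *v u)) - S *v u)"
    and ST: "S ** T = mat 1" "T ** S = mat 1"
    and fixp: "\<forall>w. transpose M *v (M *v w) = w \<longrightarrow> w = 0"
  shows "(\<forall>\<^sub>F y in nhds x. f y \<le> f x) \<longleftrightarrow> (\<forall>w. w \<noteq> 0 \<longrightarrow> norm (M *v w) < norm w)"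
    and "(\<forall>\<^sub>F y in nhds x. f x \<le> f y) \<longleftrightarrow> (\<forall>w. w \<noteq> 0 \<longrightarrow> norm (M *v w) > norm w)"
proof -
  have ST': "S *v (T *v u) = u" "T *v (S *v u) = u" "transpose T *v (transpose S *v u) = u" for u
    using ST by (simp_all add: matrix_vector_mul_assoc del: transpose_matrix_vector
        flip: matrix_transpose_mul)
  have inner: "L u \<bullet> v = (M *v (S *v u)) \<bullet> (M *v (S *v v)) - (S *v u) \<bullet> (S *v v)" for u v
    by (simp add: L inner_matrix_vector_transpose matrix_vector_mult_diff_distrib inner_diff_left
        del: transpose_matrix_vector)
  have sym: "L u \<bullet> v = u \<bullet> L v" for u v
    using inner[of u v] inner[of v u] by (simp only: inner_commute)
  have lin: "linear L"
    unfolding L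
    by (intro linearI) (simp_all add: matrix_vector_right_distrib matrix_vector_mult_diff_distrib
        matrix_vector_mult_scaleR scaleR_diff_right)
  have inj: "u = 0" if "L u = 0" for u
  proof -
    have "transpose M *v (M *v (S *v u)) - S *v u = 0"
      using ST'(3)[of "transpose M *v (M *v (S *v u)) - S *v u"] that by (simp add: L)
    then have "S *v u = 0" by (intro fixp[rule_format]) simp
    then show "u = 0" using ST'(2)[of u] by simp
  qed
  have quad: "u \<bullet> L u = (norm (M *v (S *v u)))\<^sup>2 - (norm (S *v u))\<^sup>2" for u
    by (simp only: power2_norm_eq_inner inner_commute[of u] inner)
  have all: "(\<forall>u. u \<noteq> 0 \<longrightarrow> P (S *v u)) \<longleftrightarrow> (\<forall>w. w \<noteq> 0 \<longrightarrow> P w)" for P :: "real^'k \<Rightarrow> bool"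
  proof (intro iffI allI impI)
    fix w :: "real^'k" assume "\<forall>u. u \<noteq> 0 \<longrightarrow> P (S *v u)" "w \<noteq> 0"
    moreover have "T *v w \<noteq> 0" using ST'(1)[of w] \<open>w \<noteq> 0\<close> by auto
    ultimately have "P (S *v (T *v w))" by blast
    then show "P w" by (simp add: ST')
  next
    fix u :: "real^'k" assume "\<forall>w. w \<noteq> 0 \<longrightarrow> P w" "u \<noteq> 0"
    moreover have "S *v u \<noteq> 0" using ST'(2)[of u] \<open>u \<noteq> 0\<close> by auto
    ultimately show "P (S *v u)" by blast
  qed
  have sq: "(norm a)\<^sup>2 < (norm b)\<^sup>2 \<longleftrightarrow> norm a < norm b" for a :: "real^'i" and b :: "real^'l"
    by (auto intro: power_strict_mono dest: power2_less_imp_less)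
  have "(\<forall>\<^sub>F y in nhds x. f y \<le> f x) \<longleftrightarrow> (\<forall>u. u \<noteq> 0 \<longrightarrow> norm (M *v (S *v u)) < norm (S *v u))"
    by (simp add: has_taylor2_local_max_iff[OF f lin sym inj] quad sq)
  then show "(\<forall>\<^sub>F y in nhds x. f y \<le> f x) \<longleftrightarrow> (\<forall>w. w \<noteq> 0 \<longrightarrow> norm (M *v w) < norm w)"
    using all[of "\<lambda>w. norm (M *v w) < norm w"] by simp
  have "(\<forall>\<^sub>F y in nhds x. f x \<le> f y) \<longleftrightarrow> (\<forall>u. u \<noteq> 0 \<longrightarrow> norm (M *v (S *v u)) > norm (S *v u))"
    by (simp add: has_taylor2_local_min_iff[OF f lin sym inj] quad sq)
  then show "(\<forall>\<^sub>F y in nhds x. f x \<le> f y) \<longleftrightarrow> (\<forall>w. w \<noteq> 0 \<longrightarrow> norm (M *v w) > norm w)"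
    using all[of "\<lambda>w. norm (M *v w) > norm w"] by simp
qed

text \<open>A kernel vector of \<open>M\<close> is one of \<open>N\<close>.
  \<open>matrix_inv\<close> is a choice term, so its two inverse laws follow only once invertibility
  is known. The condition \<open>\<noteq> 0\<close> suits definite forms of either sign.\<close>

lemma invertible_if_Gram_definite:
  fixes M :: "real^'k^'k"
  assumes "transpose M ** M = N" "\<forall>u. u \<noteq> 0 \<longrightarrow> u \<bullet> (N *v u) \<noteq> 0"
  shows "M ** matrix_inv M = mat 1" "matrix_inv M ** M = mat 1"
proof -
  have "u = 0" if "M *v u = 0" for u
  proof -
    have "N *v u = 0" using that assms(1) by (metis matrix_vector_mul_assoc matrix_vector_mult_0_right)
    then show ?thesis using assms(2) by auto
  qed
  then have "invertible M"
    by (simp add: invertible_left_inverse matrix_left_invertible_ker)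
  then have "\<exists>M'. M ** M' = mat 1 \<and> M' ** M = mat 1" by (simp add: invertible_def)
  then have "M ** matrix_inv M = mat 1 \<and> matrix_inv M ** M = mat 1"
    unfolding matrix_inv_def by (rule someI_ex)
  then show "M ** matrix_inv M = mat 1" "matrix_inv M ** M = mat 1" by auto
qed

section \<open>The primal function\<close>

text \<open>For symmetric matrices this is the transposed Jacobian of \<open>qvec A b c\<close> at
  \<open>x\<close>.\<close>

definition qgrad :: "('m option \<Rightarrow> real^'n^'n) \<Rightarrow> ('m option \<Rightarrow> real^'n) \<Rightarrow> real^'n \<Rightarrow> real^'m^'n" where
  "qgrad A b x = (\<chi> j i. (A (Some i) *v x - b (Some i)) $ j)"

lemma qgrad_mult: "qgrad A b x *v h = (\<Sum>i\<in>UNIV. (h $ i) *\<^sub>R (A (Some i) *v x - b (Some i)))"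
  by (simp add: vec_eq_iff qgrad_def matrix_vector_mult_def mult.commute)

lemma transpose_qgrad_mult:
  "transpose (qgrad A b x) *v u = (\<chi> i. (A (Some i) *v x - b (Some i)) \<bullet> u)"
  by (simp add: vec_eq_iff qgrad_def matrix_vector_mult_def transpose_def inner_vec_def
      del: transpose_matrix_vector)

lemma lincomb_mult:
  fixes A :: "'m::finite option \<Rightarrow> real^'n^'k"
  shows "lincomb A \<sigma> *v u = A None *v u + (\<Sum>i\<in>UNIV. (\<sigma> $ i) *\<^sub>R (A (Some i) *v u))"
proof -
  have "(\<Sum>i\<in>I. (\<sigma> $ i) *\<^sub>R A (Some i)) *v u = (\<Sum>i\<in>I. (\<sigma> $ i) *\<^sub>R (A (Some i) *v u))"
    if "finite I" for I
    using that
    by (induction I) (auto simp: matrix_vector_mult_add_rdistrib scaleR_matrix_vector_assoc[symmetric])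
  then show ?thesis
    by (simp add: lincomb_eq matrix_vector_mult_add_rdistrib)
qed

text \<open>Makes the dependence on \<open>\<sigma>\<close> explicit: the residual is affine with
  linear part \<open>qgrad\<close>. Both the gradient of the primal function and the perturbed dual
  system rest on this.\<close>

lemma lincomb_residual:
  "lincomb A \<sigma> *v x - lincomb b \<sigma> = A None *v x - b None + qgrad A b x *v \<sigma>"
  by (simp add: lincomb_mult qgrad_mult lincomb_eq[of b] scaleR_diff_right sum_subtractf)

lemma GDERIV_quad:
  assumes "transpose M = M"
  shows "GDERIV (quad M v r) y :> M *v y - v"
proof -
  have "h \<bullet> (M *v y) = (M *v h) \<bullet> y" for h
    using inner_matrix_vector_transpose[of M h y] assms by simp
  then have "y \<bullet> (M *v h) = h \<bullet> (M *v y)" for h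
    by (metis inner_commute)
  then show ?thesis
    unfolding gderiv_def quad_def
    by (intro has_derivative_eq_rhs[OF has_derivative_add[OF has_derivative_diff[OF
            has_derivative_mult_right[OF has_derivative_inner[OF has_derivative_ident
              bounded_linear_imp_has_derivative[OF matrix_vector_mul_bounded_linear]]]
            has_derivative_inner_right[OF has_derivative_ident]] has_derivative_const]])
      (auto simp: inner_diff_right inner_commute[of v])
qed

lemma has_derivative_vec_lambda:
  fixes f :: "'a::real_normed_vector \<Rightarrow> 'm::finite \<Rightarrow> real"
  assumes "\<And>i. ((\<lambda>y. f y i) has_derivative (\<lambda>h. f' h i)) F"
  shows "((\<lambda>y. \<chi> i. f y i) has_derivative (\<lambda>h. \<chi> i. f' h i)) F"
proof -
  have eq: "(\<chi> i. z i) = (\<Sum>i\<in>UNIV. z i *\<^sub>R axis i 1)" for z :: "'m \<Rightarrow> real"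
    by (simp add: vec_eq_iff axis_def if_distrib cong: if_cong)
  show ?thesis
    unfolding eq using assms by (intro has_derivative_sum has_derivative_scaleR_left)
qed

lemma has_derivative_qvec:
  assumes "\<And>k. transpose (A k) = A k"
  shows "(qvec A b c has_derivative (*v) (transpose (qgrad A b y))) (at y)"
  unfolding qvec_def transpose_qgrad_mult
proof (rule has_derivative_vec_lambda)
  show "(quad (A (Some i)) (b (Some i)) (c (Some i)) has_derivative
      (\<lambda>h. (A (Some i) *v y - b (Some i)) \<bullet> h)) (at y)" for i
    using GDERIV_quad[OF assms] by (simp add: gderiv_def inner_commute)
qed

lemma continuous_qvec:
  assumes "\<And>k. transpose (A k) = A k"
  shows "continuous_on UNIV (qvec A b c)"
  by (rule has_derivative_continuous_on) (rule has_derivative_at_withinI, rule has_derivative_qvec[where A = A, OF assms])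

lemma open_X0:
  assumes "\<And>k. transpose (A k) = A k"
  shows "open (X0 V A b c)"
  using open_vimage[OF open_interior continuous_qvec[where A = A, OF assms]] by (simp add: X0_def vimage_def)

lemma finite_on_edom:
  assumes "proper V" "y \<in> edom V"
  shows "V y = ereal (real_of_ereal (V y))"
  using assms by (cases "V y") (auto simp: proper_def edom_def)

lemma primal_eq_on_X0:
  assumes "proper V" "y \<in> X0 V A b c"
  shows "primal V A b c y = ereal (quad (A None) (b None) (c None) y + real_of_ereal (V (qvec A b c y)))"
proof -
  have "qvec A b c y \<in> edom V" using assms(2) interior_subset by (auto simp: X0_def)
  then show ?thesis
    unfolding primal_def by (subst finite_on_edom[OF assms(1)]) simp_all
qed

text \<open>The chain rule gives \<open>A None *v y - b None + qgrad A b y *v g\<close>, which is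
  the residual of the linear system with multiplier \<open>g\<close>.\<close>

lemma GDERIV_primal:
  assumes sym: "\<And>k. transpose (A k) = A k" and V: "proper V" and y: "y \<in> X0 V A b c"
    and g: "GDERIV (\<lambda>z. real_of_ereal (V z)) (qvec A b c y) :> g"
  shows "GDERIV (\<lambda>z. real_of_ereal (primal V A b c z)) y :> lincomb A g *v y - lincomb b g"
proof -
  have "((\<lambda>z. quad (A None) (b None) (c None) z + real_of_ereal (V (qvec A b c z))) has_derivative
      (\<lambda>h. h \<bullet> (A None *v y - b None) + (transpose (qgrad A b y) *v h) \<bullet> g)) (at y)"
    by (intro has_derivative_add has_derivative_compose[OF has_derivative_qvec[where A = A, OF sym]]
        GDERIV_quad[OF sym, unfolded gderiv_def] g[unfolded gderiv_def])
  then have "GDERIV (\<lambda>z. quad (A None) (b None) (c None) z + real_of_ereal (V (qvec A b c z))) y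
      :> lincomb A g *v y - lincomb b g"
    by (simp add: gderiv_def lincomb_residual inner_add_right inner_matrix_vector_transpose
        del: transpose_matrix_vector)
  \<comment> \<open>The real-valued formula is known to agree with \<open>primal\<close> on
    \<open>X0\<close>, which is open.\<close>
  then show ?thesis
    unfolding gderiv_def
    by (rule has_derivative_transform_within_open[OF _ open_X0[where A = A, OF sym] y]) (simp add: primal_eq_on_X0[OF V])
qed

text \<open>Product rule for the residual in which both the multiplier and the point vary. The
  derivative is the Hessian of the primal function: the curvature of the quadratics plus the
  curvature of \<open>V\<close> pulled back along \<open>q\<close>.\<close>

lemma has_derivative_gradient_primal:
  assumes sym: "\<And>k. transpose (A k) = A k"
    and g: "(g has_derivative (*v) W) (at (qvec A b c x))"
  shows "((\<lambda>y. lincomb A (g (qvec A b c y)) *v y - lincomb b (g (qvec A b c y))) has_derivative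
     (\<lambda>u. lincomb A (g (qvec A b c x)) *v u + qgrad A b x *v (W *v (transpose (qgrad A b x) *v u)))) (at x)"
proof -
  let ?L = "\<lambda>u. W *v (transpose (qgrad A b x) *v u)"
  have "((\<lambda>y. g (qvec A b c y)) has_derivative ?L) (at x)"
    using has_derivative_qvec[where A = A, OF sym] g by (rule has_derivative_compose)
  then have gi: "((\<lambda>y. g (qvec A b c y) $ i) has_derivative (\<lambda>u. ?L u $ i)) (at x)" for i
    by (rule bounded_linear.has_derivative[OF bounded_linear_vec_nth])
  have M: "((\<lambda>y. M *v y - v) has_derivative (*v) M) (at x)" for M :: "real^'b^'b" and v
    by (auto intro!: derivative_eq_intros bounded_linear.has_derivative[OF matrix_vector_mul_bounded_linear])
  have "((\<lambda>y. A None *v y - b None +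
      (\<Sum>i\<in>UNIV. (g (qvec A b c y) $ i) *\<^sub>R (A (Some i) *v y - b (Some i)))) has_derivative
    (\<lambda>u. A None *v u + (\<Sum>i\<in>UNIV. (g (qvec A b c x) $ i) *\<^sub>R (A (Some i) *v u) +
       (?L u $ i) *\<^sub>R (A (Some i) *v x - b (Some i))))) (at x)"
    by (intro has_derivative_add has_derivative_sum has_derivative_scaleR M gi)
  then show ?thesis
    unfolding lincomb_residual unfolding lincomb_mult qgrad_mult sum.distrib
    by (simp only: add.assoc)
qed

section \<open>The dual function\<close>

text \<open>The derivative is restricted to the two slices through the critical point. In
  \<open>y\<close> the function is a quadratic up to a constant; in \<open>\<tau>\<close> it is
  affine minus the conjugate.\<close>

lemma critical_point_XiD:
  assumes V: "proper V" and sym: "\<And>k. transpose (A k) = A k"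
    and crit: "critical_point_Xi V A b c x \<sigma>"
  shows "lincomb A \<sigma> *v x = lincomb b \<sigma>"
    and "GDERIV (\<lambda>\<tau>. real_of_ereal (fenchel_conj V \<tau>)) \<sigma> :> qvec A b c x"
proof -
  define C where "C \<tau> = real_of_ereal (fenchel_conj V \<tau>)" for \<tau>
  have fin: "fenchel_conj V \<tau> = ereal (C \<tau>)" if "\<tau> \<in> edom (fenchel_conj V)" for \<tau>
    using that fenchel_conj_gt_minf[OF V, of \<tau>]
    by (cases "fenchel_conj V \<tau>") (auto simp: edom_def C_def)
  have \<sigma>: "\<sigma> \<in> interior (edom (fenchel_conj V))"
    and der: "((\<lambda>p. real_of_ereal (Xi V A b c (fst p) (snd p))) has_derivative (\<lambda>_. 0)) (at (x, \<sigma>))"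
    using crit by (simp_all add: critical_point_Xi_def gderiv_def case_prod_unfold)
  then have \<sigma>e: "\<sigma> \<in> edom (fenchel_conj V)" using interior_subset by blast
  have "((\<lambda>y. (y, \<sigma>)) has_derivative (\<lambda>h. (h, 0))) (at x)"
    by (intro has_derivative_Pair has_derivative_ident has_derivative_const)
  from has_derivative_compose[OF this, of "\<lambda>p. real_of_ereal (Xi V A b c (fst p) (snd p))"] der
  have "((\<lambda>y. real_of_ereal (Xi V A b c y \<sigma>)) has_derivative (\<lambda>_. 0)) (at x)"
    by simp
  then have "((\<lambda>y. real_of_ereal (Xi V A b c y \<sigma>) + C \<sigma>) has_derivative (\<lambda>_. 0)) (at x)"
    by (auto intro!: derivative_eq_intros)
  moreover have "(\<lambda>y. real_of_ereal (Xi V A b c y \<sigma>) + C \<sigma>) = quad (lincomb A \<sigma>) (lincomb b \<sigma>) (lincomb c \<sigma>)"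
    by (simp add: fun_eq_iff Xi_eq fin[OF \<sigma>e] quad_def)
  ultimately have "GDERIV (quad (lincomb A \<sigma>) (lincomb b \<sigma>) (lincomb c \<sigma>)) x :> 0"
    by (simp add: gderiv_def)
  then show "lincomb A \<sigma> *v x = lincomb b \<sigma>"
    using gradient_eqI[OF GDERIV_quad[OF transpose_lincomb[where A = A, OF sym]],
        of \<sigma> "lincomb b \<sigma>" "lincomb c \<sigma>" x] gradient_eqI by fastforce
  have "((\<lambda>\<tau>. (x, \<tau>)) has_derivative (\<lambda>h. (0, h))) (at \<sigma>)"
    by (intro has_derivative_Pair has_derivative_ident has_derivative_const)
  from has_derivative_compose[OF this, of "\<lambda>p. real_of_ereal (Xi V A b c (fst p) (snd p))"] der
  have "((\<lambda>\<tau>. real_of_ereal (Xi V A b c x \<tau>)) has_derivative (\<lambda>_. 0)) (at \<sigma>)"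
    by simp
  then have "((\<lambda>\<tau>. quad (A None) (b None) (c None) x + qvec A b c x \<bullet> \<tau> - real_of_ereal (Xi V A b c x \<tau>))
      has_derivative (\<lambda>h. 0 + qvec A b c x \<bullet> h - 0)) (at \<sigma>)"
    by (intro has_derivative_diff has_derivative_add has_derivative_const
        has_derivative_inner_right has_derivative_ident)
  \<comment> \<open>Subtracting \<open>Xi\<close> from its affine part recovers the conjugate where
    the latter is finite, hence throughout the open interior of its domain.\<close>
  then have "(C has_derivative (\<lambda>h. 0 + qvec A b c x \<bullet> h - 0)) (at \<sigma>)"
  proof (rule has_derivative_transform_within_open[OF _ open_interior \<sigma>])
    fix \<tau> assume "\<tau> \<in> interior (edom (fenchel_conj V))"
    then have "\<tau> \<in> edom (fenchel_conj V)" using interior_subset by blast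
    then show "quad (A None) (b None) (c None) x + qvec A b c x \<bullet> \<tau> - real_of_ereal (Xi V A b c x \<tau>) = C \<tau>"
      by (simp add: Xi_def fin)
  qed
  then show "GDERIV (\<lambda>\<tau>. real_of_ereal (fenchel_conj V \<tau>)) \<sigma> :> qvec A b c x"
    by (simp add: gderiv_def C_def[abs_def] inner_commute)
qed

lemma sum_matrices_bound:
  fixes B :: "'m::finite \<Rightarrow> real^'n^'n"
  obtains K where "K > 0" "\<And>h u. norm (\<Sum>i\<in>UNIV. (h $ i) *\<^sub>R (B i *v u)) \<le> K * norm (h :: real^'m) * norm u"
proof
  \<comment> \<open>The summand 1 keeps the constant positive even if all \<open>B i\<close>
    vanish.\<close>
  let ?K = "1 + (\<Sum>i\<in>UNIV. onorm ((*v) (B i)))"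
  have on: "onorm ((*v) (B i)) \<ge> 0" for i by (rule onorm_pos_le) simp
  then show "?K > 0" by (intro add_pos_nonneg sum_nonneg) auto
  fix h :: "real^'m" and u :: "real^'n"
  have "norm (\<Sum>i\<in>UNIV. (h $ i) *\<^sub>R (B i *v u)) \<le> (\<Sum>i\<in>UNIV. norm ((h $ i) *\<^sub>R (B i *v u)))"
    by (rule norm_sum)
  also have "\<dots> \<le> (\<Sum>i\<in>UNIV. norm h * (onorm ((*v) (B i)) * norm u))"
    using component_le_norm_cart[of h] on
    by (intro sum_mono) (auto intro!: mult_mono onorm)
  also have "\<dots> = (\<Sum>i\<in>UNIV. onorm ((*v) (B i))) * norm h * norm u"
    by (simp add: sum_distrib_left sum_distrib_right mult_ac)
  also have "\<dots> \<le> ?K * norm h * norm u"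
    by (intro mult_right_mono) auto
  finally show "norm (\<Sum>i\<in>UNIV. (h $ i) *\<^sub>R (B i *v u)) \<le> ?K * norm h * norm u" .
qed

text \<open>\<open>P\<close> is minus the inverse of \<open>lincomb A \<sigma>\<close>. For small
  \<open>h\<close> the system at \<open>\<sigma> + h\<close> is still uniquely solvable, by
  \<open>x + u\<close> with \<open>u = P *v (G *v h) + O(|h|^2)\<close>. The dual value then
  contains \<open>((G *v h) \<bullet> u) / 2\<close>, and the linear terms cancel against the
  gradient \<open>qvec A b c x\<close> of the conjugate.\<close>

lemma has_taylor2_dual:
  fixes V :: "real^'m \<Rightarrow> ereal" and A :: "'m option \<Rightarrow> real^'n^'n"
  assumes V: "proper V" and sym: "\<And>k. transpose (A k) = A k"
    and x: "lincomb A \<sigma> *v x = lincomb b \<sigma>"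
    and P: "\<And>u. P *v (lincomb A \<sigma> *v u) = - u"
    and \<sigma>: "\<sigma> \<in> interior (edom (fenchel_conj V))"
    and C: "has_taylor2 (\<lambda>\<tau>. real_of_ereal (fenchel_conj V \<tau>)) \<sigma> (qvec A b c x) R"
  shows "\<forall>\<^sub>F \<tau> in nhds \<sigma>. \<tau> \<in> S_col V A b"
    and "has_taylor2 (dual V A b c) \<sigma> 0
       (\<lambda>h. transpose (qgrad A b x) *v (P *v (qgrad A b x *v h)) - R h)"
proof -
  define C where "C \<tau> = real_of_ereal (fenchel_conj V \<tau>)" for \<tau>
  have fin: "fenchel_conj V \<tau> = ereal (C \<tau>)" if "\<tau> \<in> edom (fenchel_conj V)" for \<tau>
    using that fenchel_conj_gt_minf[OF V, of \<tau>]
    by (cases "fenchel_conj V \<tau>") (auto simp: edom_def C_def)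
  define G where "G = qgrad A b x"
  define B where "B h u = (\<Sum>i\<in>UNIV. (h $ i) *\<^sub>R (A (Some i) *v u))" for h :: "real^'m" and u
  have AB: "lincomb A (\<sigma> + h) *v u = lincomb A \<sigma> *v u + B h u" for h u
    by (simp add: lincomb_mult B_def scaleR_left_distrib sum.distrib)
  have res: "lincomb A (\<sigma> + h) *v x - lincomb b (\<sigma> + h) = G *v h" for h
  proof -
    have "lincomb A (\<sigma> + h) *v x - lincomb b (\<sigma> + h) = (lincomb A \<sigma> *v x - lincomb b \<sigma>) + G *v h"
      unfolding lincomb_residual by (simp add: G_def matrix_vector_right_distrib)
    then show ?thesis by (simp add: x)
  qed
  obtain \<beta> where \<beta>: "\<beta> > 0" "\<And>h u. norm (B h u) \<le> \<beta> * norm h * norm u"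
    using sum_matrices_bound[of "\<lambda>i. A (Some i)"] unfolding B_def by blast
  obtain p where p: "p > 0" "\<And>u. norm (P *v u) \<le> p * norm u"
    using linear_bounded_pos[of "(*v) P"] by auto
  obtain \<gamma> where \<gamma>: "\<gamma> > 0" "\<And>h. norm (G *v h) \<le> \<gamma> * norm h"
    using linear_bounded_pos[of "(*v) G"] by auto
  \<comment> \<open>For \<open>norm h < \<rho>\<close> the perturbation satisfies
    \<open>norm (P *v B h u) \<le> norm u / 2\<close>, so the perturbed matrix stays bounded below
    and hence bijective.\<close>
  define \<rho> where "\<rho> = 1 / (2 * p * \<beta>)"
  have \<rho>: "\<rho> > 0" using p \<beta> by (simp add: \<rho>_def)
  have Pu: "u + P *v (lincomb A (\<sigma> + h) *v u) = P *v B h u" for h u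
    by (simp add: AB P matrix_vector_right_distrib)
  have PB: "norm (P *v B h u) \<le> p * \<beta> * norm h * norm u" for h u
    using p(1) by (intro order_trans[OF p(2)]) (use mult_left_mono[OF \<beta>(2), of p h u] in \<open>simp add: mult_ac\<close>)
  have bound: "norm u \<le> 2 * p * norm (lincomb A (\<sigma> + h) *v u)" if h: "norm h < \<rho>" for h u
  proof -
    have "p * \<beta> * norm h * norm u \<le> 1/2 * norm u"
      using h p \<beta> by (intro mult_right_mono) (simp_all add: \<rho>_def field_simps)
    then have "norm (P *v B h u) \<le> 1/2 * norm u" using PB[of h u] by linarith
    moreover have "norm u \<le> norm (P *v B h u) + norm (P *v (lincomb A (\<sigma> + h) *v u))"
      using norm_triangle_ineq4[of "P *v B h u" "P *v (lincomb A (\<sigma> + h) *v u)"]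
      by (simp add: Pu[symmetric])
    ultimately show ?thesis using p(2)[of "lincomb A (\<sigma> + h) *v u"] by linarith
  qed
  have surj: "surj ((*v) (lincomb A (\<sigma> + h)))" if h: "norm h < \<rho>" for h
  proof (rule linear_injective_imp_surjective)
    show "inj ((*v) (lincomb A (\<sigma> + h)))"
    proof (rule linear_injective_0[THEN iffD2, rule_format])
      show "u = 0" if "lincomb A (\<sigma> + h) *v u = 0" for u using bound[OF h, of u] that by simp
    qed simp
  qed auto
  have "\<forall>\<^sub>F \<tau> in nhds \<sigma>. \<tau> \<in> edom (fenchel_conj V)"
    using \<sigma> by (metis eventually_nhds interior_subset open_interior subset_iff)
  then have ev_dom: "\<forall>\<^sub>F h in nhds 0. \<sigma> + h \<in> edom (fenchel_conj V)"
    by (simp add: eventually_nhds_shift[of _ \<sigma>])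
  have ev_small: "\<forall>\<^sub>F h in nhds (0 :: real^'m). norm h < \<epsilon>" if "\<epsilon> > 0" for \<epsilon>
    using that unfolding eventually_nhds_metric by (auto simp: dist_norm)
  have "\<forall>\<^sub>F h in nhds 0. \<sigma> + h \<in> S_col V A b"
    using ev_dom ev_small[OF \<rho>]
  proof eventually_elim
    case (elim h)
    then show ?case using surj[of h] by (simp add: S_col_def)
  qed
  then show "\<forall>\<^sub>F \<tau> in nhds \<sigma>. \<tau> \<in> S_col V A b"
    by (simp add: eventually_nhds_shift[of _ \<sigma>])
  \<comment> \<open>\<open>u\<close> is the displacement of the solution. Passing from
    \<open>x\<close> to \<open>x + u\<close> changes \<open>Xi\<close> by \<open>(G *v h) \<bullet>
    u + (u \<bullet> (lincomb A (\<sigma> + h) *v u)) / 2\<close>, and the equation for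
    \<open>u\<close> makes the last term minus half of the first.\<close>
  have dual: "dual V A b c (\<sigma> + h) =
      quad (A None) (b None) (c None) x + qvec A b c x \<bullet> (\<sigma> + h) + ((G *v h) \<bullet> u) / 2 - C (\<sigma> + h)"
    if u: "lincomb A (\<sigma> + h) *v u = - (G *v h)" and h: "\<sigma> + h \<in> edom (fenchel_conj V)" for h u
  proof -
    define A' where "A' = lincomb A (\<sigma> + h)"
    define b' where "b' = lincomb b (\<sigma> + h)"
    have b': "b' = A' *v x - G *v h" using res[of h] by (simp add: A'_def b'_def algebra_simps)
    have u': "A' *v u = - (G *v h)" using u by (simp add: A'_def)
    have xu: "A' *v (x + u) = b'" by (simp add: matrix_vector_right_distrib u' b')
    have "transpose A' = A'" unfolding A'_def by (rule transpose_lincomb) (rule sym)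
    then have "(A' *v x) \<bullet> u = x \<bullet> (A' *v u)"
      by (metis inner_matrix_vector_transpose)
    then have xu2: "(A' *v x) \<bullet> u = - ((G *v h) \<bullet> x)"
      by (simp add: u' inner_commute)
    have q: "quad (A None) (b None) (c None) x + qvec A b c x \<bullet> (\<sigma> + h) =
        1/2 * (x \<bullet> (A' *v x)) - b' \<bullet> x + lincomb c (\<sigma> + h)"
      using Xi_eq[of V A b c x "\<sigma> + h"] by (simp add: Xi_def fin[OF h] A'_def b'_def)
    have "dual V A b c (\<sigma> + h) = real_of_ereal (Xi V A b c (x + u) (\<sigma> + h))"
      using xu by (intro dual_eq sym) (simp add: A'_def b'_def)
    also have "\<dots> = 1/2 * ((x + u) \<bullet> (A' *v (x + u))) - b' \<bullet> (x + u) + lincomb c (\<sigma> + h) - C (\<sigma> + h)"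
      by (simp add: Xi_eq fin[OF h] A'_def b'_def)
    also have "\<dots> = - (b' \<bullet> (x + u)) / 2 + lincomb c (\<sigma> + h) - C (\<sigma> + h)"
      by (simp add: xu inner_commute)
    finally show ?thesis
      unfolding q using xu2 by (simp add: b' inner_add_right inner_diff_left inner_commute[of x] field_simps)
  qed
  have \<sigma>e: "\<sigma> \<in> edom (fenchel_conj V)" using \<sigma> interior_subset by blast
  have dual0: "dual V A b c \<sigma> = quad (A None) (b None) (c None) x + qvec A b c x \<bullet> \<sigma> - C \<sigma>"
    using dual[of 0 0] \<sigma>e by simp
  show "has_taylor2 (dual V A b c) \<sigma> 0 (\<lambda>h. transpose (qgrad A b x) *v (P *v (qgrad A b x *v h)) - R h)"
    unfolding has_taylor2_def G_def[symmetric]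
  proof (intro allI impI)
    fix e :: real assume "e > 0"
    \<comment> \<open>Product of the bounds for \<open>G *v h\<close>, for \<open>P *v B h u\<close>
      and for \<open>u\<close>: the error of replacing \<open>u\<close> by
      \<open>P *v (G *v h)\<close> is at most \<open>\<kappa> * norm h ^ 3\<close>. It enters the
      dual halved, as does the error budget for the conjugate.\<close>
    define \<kappa> where "\<kappa> = \<gamma> * p * \<beta> * (2 * p * \<gamma>)"
    have \<kappa>: "\<kappa> > 0" using \<gamma> p \<beta> by (simp add: \<kappa>_def)
    have "e / 2 > 0" "e / \<kappa> > 0" using \<open>e > 0\<close> \<kappa> by simp_all
    have "\<forall>\<^sub>F h in nhds 0. \<bar>C (\<sigma> + h) - C \<sigma> - qvec A b c x \<bullet> h - (h \<bullet> R h) / 2\<bar> \<le> e / 2 * (norm h)\<^sup>2"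
      using C \<open>e / 2 > 0\<close> unfolding has_taylor2_def C_def by blast
    with ev_dom ev_small[OF \<rho>] ev_small[OF \<open>e / \<kappa> > 0\<close>]
    show "\<forall>\<^sub>F h in nhds 0. \<bar>dual V A b c (\<sigma> + h) - dual V A b c \<sigma> - 0 \<bullet> h -
        (h \<bullet> (transpose G *v (P *v (G *v h)) - R h)) / 2\<bar> \<le> e * (norm h)\<^sup>2"
    proof eventually_elim
      case (elim h)
      obtain u where u: "lincomb A (\<sigma> + h) *v u = - (G *v h)"
        using surj[OF elim(2)] by (metis surjD)
      have "norm u \<le> 2 * p * norm (G *v h)" using bound[OF elim(2), of u] by (simp add: u)
      also have "\<dots> \<le> 2 * p * (\<gamma> * norm h)" using \<gamma>(2)[of h] p(1) by simp
      finally have nu: "norm u \<le> 2 * p * \<gamma> * norm h" by simp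
      have "u - P *v (G *v h) = P *v B h u" using Pu[of u h] by (simp add: u matrix_vector_mult_minus_right)
      then have "\<bar>(G *v h) \<bullet> (u - P *v (G *v h))\<bar> \<le> norm (G *v h) * norm (P *v B h u)"
        by (metis Cauchy_Schwarz_ineq2)
      also have "\<dots> \<le> (\<gamma> * norm h) * (p * \<beta> * norm h * (2 * p * \<gamma> * norm h))"
        using \<gamma> p \<beta> nu by (intro mult_mono order_trans[OF PB] mult_left_mono) auto
      also have "\<dots> = (\<kappa> * norm h) * (norm h)\<^sup>2" by (simp add: \<kappa>_def power2_eq_square)
      also have "\<dots> \<le> e * (norm h)\<^sup>2"
        using elim(3) \<kappa> by (intro mult_right_mono) (auto simp: field_simps)
      finally have 1: "\<bar>(G *v h) \<bullet> u - (G *v h) \<bullet> (P *v (G *v h))\<bar> \<le> e * (norm h)\<^sup>2"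
        by (simp add: inner_diff_right)
      have "h \<bullet> (transpose G *v (P *v (G *v h)) - R h) = (G *v h) \<bullet> (P *v (G *v h)) - h \<bullet> R h"
        by (simp only: inner_diff_right inner_matrix_vector_transpose)
      moreover have "dual V A b c (\<sigma> + h) - dual V A b c \<sigma> =
          qvec A b c x \<bullet> h + ((G *v h) \<bullet> u) / 2 - (C (\<sigma> + h) - C \<sigma>)"
        using dual[OF u elim(1)] dual0 by (simp add: inner_add_right)
      moreover have "\<bar>C (\<sigma> + h) - C \<sigma> - qvec A b c x \<bullet> h - (h \<bullet> R h) / 2\<bar> \<le> (e * (norm h)\<^sup>2) / 2"
        using elim(4) by simp
      ultimately show ?case using 1 unfolding inner_zero_left abs_le_iff by linarith
    qed
  qed
qed

lemma local_extremizer_on_nhd_iff: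
  assumes "\<forall>\<^sub>F y in nhds x. y \<in> S"
  shows "local_maximizer_on S f x \<longleftrightarrow> (\<forall>\<^sub>F y in nhds x. f y \<le> f x)"
    and "local_minimizer_on S f x \<longleftrightarrow> (\<forall>\<^sub>F y in nhds x. f x \<le> f y)"
proof -
  have x: "x \<in> S" using assms by (rule eventually_nhds_x_imp_x)
  have "(\<exists>e>0. \<forall>y\<in>S \<inter> ball x e. P y) \<longleftrightarrow> (\<forall>\<^sub>F y in nhds x. P y)" for P
  proof -
    have "(\<exists>e>0. \<forall>y\<in>S \<inter> ball x e. P y) \<longleftrightarrow> (\<forall>\<^sub>F y in nhds x. y \<in> S \<longrightarrow> P y)"
      unfolding eventually_nhds_metric by (auto simp: dist_commute)
    also have "\<dots> \<longleftrightarrow> (\<forall>\<^sub>F y in nhds x. P y)"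
      by (rule eventually_cong[OF assms]) simp
    finally show ?thesis .
  qed
  then show "local_maximizer_on S f x \<longleftrightarrow> (\<forall>\<^sub>F y in nhds x. f y \<le> f x)"
    "local_minimizer_on S f x \<longleftrightarrow> (\<forall>\<^sub>F y in nhds x. f x \<le> f y)"
    using x by (simp_all add: local_maximizer_on_def local_minimizer_on_def)
qed

lemma Gamma_sc2D:
  assumes "V \<in> Gamma_sc2" and "y \<in> interior (edom V)"
  shows "proper V" "econvex V"
    and "GDERIV (\<lambda>z. real_of_ereal (V z)) y :> gradient (\<lambda>z. real_of_ereal (V z)) y"
    and "(gradient (\<lambda>z. real_of_ereal (V z)) has_derivative
          (*v) (hessian (\<lambda>z. real_of_ereal (V z)) y)) (at y)"
    and "pos_definite (hessian (\<lambda>z. real_of_ereal (V z)) y)"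
proof -
  show "proper V" "econvex V" "pos_definite (hessian (\<lambda>z. real_of_ereal (V z)) y)"
    using assms by (auto simp: Gamma_sc2_def Gamma_sc_def Gamma_def)
  show "GDERIV (\<lambda>z. real_of_ereal (V z)) y :> gradient (\<lambda>z. real_of_ereal (V z)) y"
    using assms by (intro GDERIV_gradient) (auto simp: Gamma_sc2_def Gamma_sc_def essentially_smooth_def)
  have "gradient (\<lambda>z. real_of_ereal (V z)) differentiable (at y)"
    using assms by (auto simp: Gamma_sc2_def)
  then show "(gradient (\<lambda>z. real_of_ereal (V z)) has_derivative
      (*v) (hessian (\<lambda>z. real_of_ereal (V z)) y)) (at y)"
    unfolding hessian_def jacobian_works .
qed

text \<open>\<open>hessian\<close> differentiates \<open>gradient\<close>, a description operator,
  so a known gradient field is first identified with it on an open neighbourhood of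
  \<open>x\<close>.\<close>

lemma hessian_eqI:
  assumes "\<forall>\<^sub>F y in nhds x. GDERIV f y :> g y" and "(g has_derivative L) (at x)"
  shows "hessian f x *v u = L u"
proof -
  have "\<forall>\<^sub>F y in nhds x. gradient f y = g y"
    using assms(1) by eventually_elim (rule gradient_eqI)
  then obtain S where S: "open S" "x \<in> S" "\<And>y. y \<in> S \<Longrightarrow> gradient f y = g y"
    unfolding eventually_nhds by blast
  have "(gradient f has_derivative L) (at x)"
    using assms(2) S(1,2) by (rule has_derivative_transform_within_open) (simp add: S(3))
  moreover from this have "(gradient f has_derivative (*v) (hessian f x)) (at x)"
    unfolding hessian_def jacobian_works[symmetric] differentiable_def by blast
  ultimately have "L = (*v) (hessian f x)" by (rule has_derivative_unique)
  then show ?thesis by simp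
qed

theorem corollary10:
  fixes V :: "real^'m \<Rightarrow> ereal"
    and A :: "'m option \<Rightarrow> real^'n^'n"
    and b :: "'m option \<Rightarrow> real^'n"
    and c :: "'m option \<Rightarrow> real"
    and x :: "real^'n" and \<sigma> :: "real^'m"
    and E :: "real^'n^'n" and F :: "real^'m^'m"
    and d :: "'m \<Rightarrow> real^'n"
    and J H :: "real^'m \<Rightarrow> real^'n"
  assumes "V \<in> Gamma_sc2"
    and "\<And>k. transpose (A k) = A k"
    and "x \<in> X0 V A b c" and "\<sigma> \<in> S_neg V A"
    and "critical_point_Xi V A b c x \<sigma>"
    and "det (hessian (\<lambda>y. real_of_ereal (primal V A b c y)) x) \<noteq> 0"
    and "transpose E ** E = - lincomb A \<sigma>"
    and "transpose F ** F = hessian (\<lambda>y. real_of_ereal (V y)) (qvec A b c x)"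
    and "\<And>i. d i = transpose (matrix_inv E) *v (A (Some i) *v x - b (Some i))"
    and "\<And>v. J v = (\<Sum>i\<in>UNIV. (v $ i) *\<^sub>R d i)"
    and "H = J \<circ> (*v) (transpose F)"
  shows "((local_maximizer_on UNIV (primal V A b c) x \<longleftrightarrow> (\<forall>v\<in>sphere 0 1. norm (H v) < 1)) \<and>
          ((\<forall>v\<in>sphere 0 1. norm (H v) < 1) \<longleftrightarrow> local_maximizer_on (S_col V A b) (dual V A b c) \<sigma>)) \<and>
         (CARD('m) = CARD('n) \<longrightarrow>
          (local_minimizer_on UNIV (primal V A b c) x \<longleftrightarrow> (\<forall>v\<in>sphere 0 1. norm (H v) > 1)) \<and>
          ((\<forall>v\<in>sphere 0 1. norm (H v) > 1) \<longleftrightarrow> local_minimizer_on (S_col V A b) (dual V A b c) \<sigma>))"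
proof -

  \<comment> \<open>Notation and the relation between the gradient of V at q(x) and the critical
    multiplier\<close>
  note sym = assms(2)
  define r where "r = (\<lambda>z. real_of_ereal (V z))"
  define f where "f = (\<lambda>y. real_of_ereal (primal V A b c y))"
  define W where "W = hessian r (qvec A b c x)"
  define G where "G = qgrad A b x"
  define Ei where "Ei = matrix_inv E"
  define Fi where "Fi = matrix_inv F"
  define M where "M = transpose Ei ** (G ** transpose F)"
  have qx: "qvec A b c x \<in> interior (edom V)" using assms(3) by (simp add: X0_def)
  note V = Gamma_sc2D[OF assms(1) qx, folded r_def]
  note W = V(5)[folded W_def, unfolded pos_definite_def]
  note gV = Gamma_sc2D(3)[OF assms(1), folded r_def]
  have \<sigma>: "\<sigma> \<in> interior (edom (fenchel_conj V))" using assms(5) by (simp add: critical_point_Xi_def)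
  note crit = critical_point_XiD[where A = A, OF V(1) sym assms(5)]
  have grad: "gradient r (qvec A b c x) = \<sigma>"
    using gradient_conj_imp_gradient[OF V(1,2) qx _ V(3)[unfolded r_def] crit(2)] \<sigma> interior_subset
    unfolding r_def by blast

  \<comment> \<open>Invertibility of E and F, and the matrix M of H\<close>
  have neg: "neg_definite (lincomb A \<sigma>)" using assms(4) by (simp add: S_neg_def)
  have "\<forall>u. u \<noteq> 0 \<longrightarrow> u \<bullet> ((- lincomb A \<sigma>) *v u) \<noteq> 0"
    using neg by (force simp: neg_definite_def matrix_vector_mult_minus_left)
  note E = invertible_if_Gram_definite[OF assms(7) this, folded Ei_def]
  have "\<forall>u. u \<noteq> 0 \<longrightarrow> u \<bullet> (W *v u) \<noteq> 0"
    using W by (metis less_irrefl)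
  note F = invertible_if_Gram_definite[OF assms(8)[folded r_def, folded W_def] this, folded Fi_def]
  have Et: "transpose Ei ** transpose E = mat 1" "transpose E ** transpose Ei = mat 1"
    and Ft: "transpose Fi ** transpose F = mat 1" "transpose F ** transpose Fi = mat 1"
    using E F by (simp_all flip: matrix_transpose_mul)
  have cancel: "E *v (Ei *v u) = u" "Ei *v (E *v u) = u" "transpose Ei *v (transpose E *v u) = u"
    "transpose E *v (transpose Ei *v u) = u" for u
    using E Et by (simp_all add: matrix_vector_mul_assoc del: transpose_matrix_vector)
  have cancelF: "F *v (Fi *v u) = u" "Fi *v (F *v u) = u" "transpose Fi *v (transpose F *v u) = u"
    "transpose F *v (transpose Fi *v u) = u" for u
    using F Ft by (simp_all add: matrix_vector_mul_assoc del: transpose_matrix_vector)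
  have A\<sigma>: "lincomb A \<sigma> *v u = - (transpose E *v (E *v u))" for u
  proof -
    have "lincomb A \<sigma> = - (transpose E ** E)" using assms(7) by simp
    then show ?thesis by (simp add: matrix_vector_mul_assoc matrix_vector_mult_minus_left
          del: transpose_matrix_vector)
  qed
  have WF: "W *v u = transpose F *v (F *v u)" for u
    using assms(8) by (simp add: W_def r_def matrix_vector_mul_assoc del: transpose_matrix_vector)
  have Mv: "M *v v = transpose Ei *v (G *v (transpose F *v v))" for v
    by (simp add: M_def matrix_vector_mul_assoc matrix_mul_assoc del: transpose_matrix_vector)
  have Mt: "transpose M *v v = F *v (transpose G *v (Ei *v v))" for v
    by (simp add: M_def matrix_transpose_mul matrix_vector_mul_assoc matrix_mul_assoc del: transpose_matrix_vector)
  have H: "H v = M *v v" for v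
  proof -
    have "transpose Ei *v (\<Sum>i\<in>UNIV. (w $ i) *\<^sub>R (A (Some i) *v x - b (Some i))) = J w" for w
      unfolding assms(10) assms(9) Ei_def
      by (simp add: linear_sum[of "(*v) (transpose (matrix_inv E))"] matrix_vector_mult_scaleR
          del: transpose_matrix_vector)
    then show ?thesis by (simp add: Mv assms(11) G_def qgrad_mult del: transpose_matrix_vector)
  qed

  \<comment> \<open>Second-order test for the primal function\<close>
  define pg where "pg y = lincomb A (gradient r (qvec A b c y)) *v y - lincomb b (gradient r (qvec A b c y))" for y
  define Lp where "Lp u = lincomb A \<sigma> *v u + G *v (W *v (transpose G *v u))" for u
  have "\<forall>\<^sub>F y in nhds x. y \<in> X0 V A b c"
    using open_X0[where A = A, OF sym] assms(3) by (rule eventually_nhds_in_open)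
  then have ev: "\<forall>\<^sub>F y in nhds x. GDERIV f y :> pg y"
    unfolding f_def pg_def
    by eventually_elim (rule GDERIV_primal[where A = A, OF sym V(1)], assumption, fold r_def,
        rule gV, simp add: X0_def)
  have pg': "(pg has_derivative Lp) (at x)"
    using has_derivative_gradient_primal[where A = A, OF sym V(4)[folded W_def]]
    unfolding pg_def[abs_def] Lp_def[abs_def] G_def grad .
  have "pg x = 0" by (simp add: pg_def grad crit(1))
  then have tay_p: "has_taylor2 f x 0 Lp" using has_taylor2_gradient[OF ev pg'] by simp
  \<comment> \<open>The Gram form with \<open>S = E\<close> and with \<open>transpose M\<close> in
    the role of \<open>M\<close>; the double transpose is kept to match that pattern.\<close>
  have Lp: "Lp u = transpose E *v (transpose (transpose M) *v (transpose M *v (E *v u)) - E *v u)" for u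
    unfolding transpose_transpose Mt Mv matrix_vector_mult_diff_distrib cancel
    by (simp add: Lp_def A\<sigma> WF del: transpose_matrix_vector)
  \<comment> \<open>A fixed vector \<open>w\<close> would put \<open>Ei *v w\<close> in the kernel
    of the Hessian, which is trivial because its determinant is nonzero.\<close>
  have fix_p: "\<forall>w. M *v (transpose M *v w) = w \<longrightarrow> w = 0"
  proof (intro allI impI)
    fix w assume w: "M *v (transpose M *v w) = w"
    have "hessian f x *v (Ei *v w) = 0"
      using w by (simp only: hessian_eqI[OF ev pg'] Lp cancel transpose_transpose) simp
    moreover have "invertible (hessian f x)"
      using assms(6) by (simp add: invertible_det_nz f_def)
    ultimately have "Ei *v w = 0"
      using matrix_left_invertible_ker invertible_left_inverse by blast
    then show "w = 0" using cancel(1)[of w] by simp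
  qed
  note fix_d = transpose_Gram_fixed_points[OF fix_p]
  note primal_iff = has_taylor2_Gram_extremum_iff[OF tay_p Lp E, unfolded transpose_transpose, OF fix_p]

  \<comment> \<open>Second-order test for the dual function\<close>
  \<comment> \<open>By the Gram factorizations \<open>R\<close> is the inverse of \<open>W\<close>
    and \<open>P\<close> is minus the inverse of \<open>lincomb A \<sigma>\<close>.\<close>
  define R where "R = Fi ** transpose Fi"
  define P where "P = Ei ** transpose Ei"
  have R: "R *v u = Fi *v (transpose Fi *v u)" for u
    by (simp add: R_def matrix_vector_mul_assoc del: transpose_matrix_vector)
  have P: "P *v u = Ei *v (transpose Ei *v u)" for u
    by (simp add: P_def matrix_vector_mul_assoc del: transpose_matrix_vector)
  have "\<forall>\<^sub>F z in nhds (qvec A b c x). z \<in> interior (edom V)"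
    using qx by (intro eventually_nhds_in_open) auto
  then have "\<forall>\<^sub>F z in nhds (qvec A b c x). GDERIV r z :> gradient r z"
    by eventually_elim (rule gV)
  then have "has_taylor2 r (qvec A b c x) \<sigma> ((*v) W)"
    using has_taylor2_gradient[OF _ V(4)[folded W_def]] grad by simp
  then have conj: "has_taylor2 (\<lambda>\<tau>. real_of_ereal (fenchel_conj V \<tau>)) \<sigma> (qvec A b c x) ((*v) R)"
    unfolding r_def
  proof (rule has_taylor2_fenchel_conj[OF V(1,2) qx])
    show "(W *v h) \<bullet> k = h \<bullet> (W *v k)" for h k
      using W by (metis inner_matrix_vector_transpose)
    show "W *v (R *v h) = h" for h
      by (simp add: WF R cancelF del: transpose_matrix_vector)
  qed (use W in auto)
  have PA: "P *v (lincomb A \<sigma> *v u) = - u" for u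
    using cancel by (simp add: A\<sigma> P matrix_vector_mult_minus_right del: transpose_matrix_vector)
  note tay_d = has_taylor2_dual[where A = A, OF V(1) sym crit(1) PA \<sigma> conj, folded G_def]
  \<comment> \<open>The Gram form with \<open>S = transpose Fi\<close> and this time with
    \<open>M\<close> itself.\<close>
  have Ld: "transpose G *v (P *v (G *v h)) - R *v h = transpose (transpose Fi) *v
      (transpose M *v (M *v (transpose Fi *v h)) - transpose Fi *v h)" for h
    unfolding transpose_transpose Mt Mv matrix_vector_mult_diff_distrib cancelF
    by (simp only: P R)
  note dual_iff = has_taylor2_Gram_extremum_iff[OF tay_d(2) Ld Ft fix_d]

  \<comment> \<open>Passage to local extremizers and conclusion\<close>
  have ev_primal: "\<forall>\<^sub>F y in nhds x. primal V A b c y = ereal (f y)"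
    using \<open>\<forall>\<^sub>F y in nhds x. y \<in> X0 V A b c\<close>
    by eventually_elim (simp add: f_def primal_eq_on_X0[OF V(1)])
  have x_primal: "primal V A b c x = ereal (f x)"
    using ev_primal by (rule eventually_nhds_x_imp_x)
  have max_p: "local_maximizer_on UNIV (primal V A b c) x \<longleftrightarrow> (\<forall>\<^sub>F y in nhds x. f y \<le> f x)"
    and min_p: "local_minimizer_on UNIV (primal V A b c) x \<longleftrightarrow> (\<forall>\<^sub>F y in nhds x. f x \<le> f y)"
    unfolding local_extremizer_on_nhd_iff[where S = UNIV, simplified] x_primal
    by (rule eventually_cong[OF ev_primal], simp)+
  \<comment> \<open>The primal test concerns \<open>transpose M\<close>, the dual test and
    \<open>H\<close> concern \<open>M\<close>. Contraction passes between the two in any dimensions,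
    expansion here under equal dimensions.\<close>
  have less: "(\<forall>w. w \<noteq> 0 \<longrightarrow> norm (transpose M *v w) < norm w) \<longleftrightarrow> (\<forall>v. v \<noteq> 0 \<longrightarrow> norm (M *v v) < norm v)"
    using norm_transpose_less[of M] norm_transpose_less[of "transpose M"]
    unfolding transpose_transpose by blast
  have greater: "(\<forall>w. w \<noteq> 0 \<longrightarrow> norm (transpose M *v w) > norm w) \<longleftrightarrow> (\<forall>v. v \<noteq> 0 \<longrightarrow> norm (M *v v) > norm v)"
    if "CARD('m) = CARD('n)"
    using norm_transpose_greater[OF that, of M] norm_transpose_greater[OF that[symmetric], of "transpose M"]
    unfolding transpose_transpose by blast
  show ?thesis
    unfolding H norm_sphere_iff max_p min_p primal_iff local_extremizer_on_nhd_iff[OF tay_d(1)] dual_iff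
    using less greater by blast
qed

end
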